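(* Let $n\ge1$ be fixed. For monic polynomials $p,q$ of degree $d\ge n$, \[ \kappa_n^d(p\boxtimes_d q)= \sum_{\pi\in NC(n)} \kappa_\pi^d(p)\, \kappa_{Kr(\pi)}^d(q)+ O(1/d) \qquad\text{and}\qquad m_n(p\boxtimes_d q)= \sum_{\pi\in NC(n)} \kappa_\pi^d(p)\, m_{Kr(\pi)}(q)+ O(1/d).\]
   Context: For a monic polynomial $p$ of degree $d$ with roots $\lambda_1,\dots,\lambda_d$ write $p(x)=\sum_{i=0}^d (-1)^i a_i^p x^{d-i}$ ($a_0^p=1$). Moments: $m_n(p)=\frac1d\sum_i\lambda_i^n$. The finite free multiplicative convolution $p\boxtimes_d q$ is the monic polynomial of degree $d$ with $a_k^{p\boxtimes_d q}=a_k^pa_k^q/\binom{d}{k}$. Let $(d)_k=d(d-1)\cdots(d-k+1)$. $P(n)$ denotes set partitions of $\{1,\dots,n\}$, $|\pi|$ the number of blocks; for a sequence $(u_j)$, $u_\pi=\prod_{V\in\pi}u_{|V|}$; $a^p_\pi=\prod_{V}a^p_{|V|}$, $N!_\pi=\prod_V|V|!$, $(d)_\pi=\prod_V(d)_{|V|}$. Finite free cumulants: for $n=1,\dots,d$, \[\kappa_n^d(p)=\frac{(-d)^n}{d(n-1)!}\sum_{\pi\in P(n)}(-1)^{|\pi|}\frac{N!_\pi a_\pi^p(|\pi|-1)!}{(d)_\pi},\] and $\kappa^d_\pi(p)=\prod_{V\in\pi}\kappa^d_{|V|}(p)$, $m_\pi(q)=\prod_V m_{|V|}(q)$. $NC(n)\subset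 P(n)$ is the set of non-crossing partitions (no $i<j<k<l$ with $i,k$ in one block and $j,l$ in a different block). For $\pi\in NC(n)$, its Kreweras complement $Kr(\pi)$ is the partition whose blocks are the cycles of the permutation $\alpha^{-1}\gamma_n$, where $\gamma_n=(1,2,\dots,n)$ and $\alpha$ is the permutation whose cycles are the blocks of $\pi$, each traversed in increasing order. Here $O(1/d)$ stands for an expression $\sum_{k=1}^{n-1}d^{-k}E_k$, where each $E_k$ is a linear combination, with coefficients depending only on $n$ and $k$ (not on $d$, $p$, $q$), of products $\kappa^d_\sigma(p)\kappa^d_\tau(q)$ (respectively $\kappa^d_\sigma(p)m_\tau(q)$) with $\sigma,\tau\in P(n)$. *)

theory Defs
  imports
    Complex_Main
    "HOL-Computational_Algebra.Polynomial"
    "HOL-Library.Disjoint_Sets"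
    "HOL-Combinatorics.Combinatorics"
begin

definition set_partitions :: "nat \<Rightarrow> nat set set set" where
  "set_partitions n = {\<pi>. partition_on {1..n} \<pi>}"

definition part_prod :: "(nat \<Rightarrow> 'a :: comm_monoid_mult) \<Rightarrow> nat set set \<Rightarrow> 'a" where
  "part_prod u \<pi> = (\<Prod>V\<in>\<pi>. u (card V))"

definition noncrossing_partitions :: "nat \<Rightarrow> nat set set set" where
  "noncrossing_partitions n = {\<pi> \<in> set_partitions n.
     \<not> (\<exists>i j k l. \<exists>V\<in>\<pi>. \<exists>W\<in>\<pi>. i < j \<and> j < k \<and> k < l \<and>
          i \<in> V \<and> k \<in> V \<and> j \<in> W \<and> l \<in> W \<and> V \<noteq> W)}"

text \<open>The permutation whose cycles are the blocks of \<open>\<pi>\<close>, each traversed in increasing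
  order; it fixes every point outside \<open>\<Union>\<pi>\<close>.\<close>

definition partition_perm :: "nat set set \<Rightarrow> nat \<Rightarrow> nat" where
  "partition_perm \<pi> i =
     (if i \<in> \<Union>\<pi> then cycle_of_list (sorted_list_of_set (THE V. V \<in> \<pi> \<and> i \<in> V)) i else i)"

text \<open>The blocks are the cycles of \<open>\<alpha>\<inverse> \<gamma>\<^sub>n\<close>, where
  \<open>\<gamma>\<^sub>n\<close> is the full cycle \<open>1 \<mapsto> 2 \<mapsto> \<dots> \<mapsto> n \<mapsto> 1\<close>
  and products are composed from right to left.\<close>

definition kreweras :: "nat \<Rightarrow> nat set set \<Rightarrow> nat set set" where
  "kreweras n \<pi> = orbit (inv (partition_perm \<pi>) \<circ> cycle_of_list [1..<Suc n]) ` {1..n}"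

text \<open>The numbers \<open>a\<^sub>i\<close> in \<open>p(x) = \<Sum>i\<le>d. (-1)\<^sup>i a\<^sub>i x\<^bsup>d-i\<^esup>\<close>,
  where \<open>d\<close> is the degree of \<open>p\<close>; meaningful for \<open>i \<le> d\<close> only.\<close>

definition sgn_coeff :: "complex poly \<Rightarrow> nat \<Rightarrow> complex" where
  "sgn_coeff p i = (-1) ^ i * coeff p (degree p - i)"

definition moment :: "complex poly \<Rightarrow> nat \<Rightarrow> complex" where
  "moment p n = (\<Sum>z\<in>#proots p. z ^ n) / of_nat (degree p)"

definition ff_mult_conv :: "nat \<Rightarrow> complex poly \<Rightarrow> complex poly \<Rightarrow> complex poly" where
  "ff_mult_conv d p q =
     (\<Sum>k\<le>d. monom ((-1) ^ k * (sgn_coeff p k * sgn_coeff q k / of_nat (d choose k))) (d - k))"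

definition falling :: "nat \<Rightarrow> nat \<Rightarrow> nat" where
  "falling d k = (\<Prod>i<k. d - i)"

text \<open>Meant for \<open>1 \<le> n \<le> d\<close> and \<open>p\<close> monic of degree \<open>d\<close>.\<close>

definition ff_cumulant :: "nat \<Rightarrow> complex poly \<Rightarrow> nat \<Rightarrow> complex" where
  "ff_cumulant d p n =
     (- of_nat d) ^ n / (of_nat d * fact (n - 1)) *
     (\<Sum>\<pi>\<in>set_partitions n.
        (-1) ^ card \<pi> *
        (part_prod fact \<pi> * part_prod (sgn_coeff p) \<pi> * fact (card \<pi> - 1)) /
        of_nat (part_prod (falling d) \<pi>))"

end

theory Submission
  imports
    Defs
    "HOL-Computational_Algebra.Formal_Power_Series"
    "HOL-Computational_Algebra.Polynomial_FPS"
    "HOL-Computational_Algebra.Fundamental_Theorem_Algebra"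
begin

text \<open>
  Put \<open>u\<^sub>j = - d \<kappa>\<^sub>j(p) / (- d)\<^sup>j\<close>. Inverting the logarithm in the definition of the cumulants,
  \<open>k! a\<^sub>k / (d)\<^sub>k\<close> is the sum over the permutations of \<open>k\<close> points of the product of \<open>u\<close> over the cycle
  lengths, and Newton's identities give the same description of \<open>k! a\<^sub>k\<close> in terms of the moments.
  Multiplicative convolution multiplies these numbers, hence turns them into sums over pairs
  \<open>(f, g)\<close> of permutations; sorting the pairs by the joint orbits of \<open>f\<close> and \<open>g\<close> shows that the
  cumulant (moment) of the convolution is, up to a factor, the sum over the transitive pairs on \<open>n\<close>
  points, a pair with \<open>r\<close> cycles in total carrying the power \<open>d\<close> to the \<open>r - n - 1\<close>.
  By the genus inequality \<open>r \<le> n + 1\<close>, with equality only if \<open>f \<circ> g\<close> is an \<open>n\<close>-cycle. The \<open>(n - 1)!\<close>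
  \<open>n\<close>-cycles are conjugate, and the factorizations of \<open>1 \<mapsto> 2 \<mapsto> \<dots> \<mapsto> n \<mapsto> 1\<close> with equality are
  exactly the pairs given by a noncrossing partition and its Kreweras complement.
\<close>

section \<open>Cycles under multiplication by a transposition\<close>

text \<open>The form of \<open>u\<close> comes from the powers of \<open>- d\<close>. On
  \<open>n\<close> points with \<open>c\<close> cycles, the factors
  \<open>- d * \<kappa>\<^sub>j / (- d) ^ j\<close> multiply to \<open>(- d) ^ c / (- d) ^ n\<close>
  times a product of cumulants; with the same normalisation on the convolution side, a pair with
  \<open>r\<close> cycles keeps exactly \<open>(- d) ^ (r - n - 1)\<close>. The expansion is
  therefore an identity for every \<open>d \<ge> n\<close>, its error coefficients are signed counts
  of pairs and free of \<open>d\<close>, and \<open>r \<ge> 2\<close> stops the powers of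
  \<open>1 / d\<close> at \<open>n - 1\<close>.

  For \<open>k \<le> d\<close> the number \<open>k! a\<^sub>k / (d)\<^sub>k\<close> is
  \<open>a\<^sub>k\<close> over \<open>d choose k\<close>, which is why the convolution multiplies
  these numbers. For moments only the factor \<open>p\<close> carries the division by
  \<open>(d)\<^sub>k\<close>, and a single scheme with a parameter covers both cases.

  The obstacle is that a termwise product of exponential generating functions has no usable formula
  for its logarithm. Counting replaces it: the logarithm of a series counting pairs counts pairs
  with one joint orbit. Since the coefficients make sense only up to index \<open>d\<close>, this is
  phrased as a recurrence truncated at \<open>d\<close> rather than as an identity of power
  series.\<close>

definition orbits :: "('a \<Rightarrow> 'a) \<Rightarrow> 'a set \<Rightarrow> 'a set set" where
  "orbits f A = orbit f ` A"

text \<open>\<open>orbit f x\<close> is generated from \<open>f x\<close>, not from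
  \<open>x\<close>; that it comes back to \<open>x\<close> rests on finiteness.\<close>

lemma permutes_self_in_orbit:
  assumes "f permutes A" "finite A"
  shows "x \<in> orbit f x"
  using assms permutation_self_in_orbit permutes_imp_permutation by metis

lemma permutes_orbit_eq:
  assumes "f permutes A" "finite A" "y \<in> orbit f x"
  shows "orbit f y = orbit f x"
  using orbit_cyclic_eq3[OF cyclic_on_orbit[OF assms(1,2)] assms(3)] .

lemma permutes_mem_orbit_iff:
  assumes "f permutes A" "finite A"
  shows "y \<in> orbit f x \<longleftrightarrow> orbit f y = orbit f x"
  using permutes_orbit_eq[OF assms] permutes_self_in_orbit[OF assms] by blast

lemma permutes_orbit_step:
  assumes "f permutes A" "finite A"
  shows "orbit f (f x) = orbit f x"
  using permutes_orbit_eq[OF assms orbit.base] .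

lemma orbit_subset_invariant:
  assumes "x \<in> S" "f ` S \<subseteq> S"
  shows "orbit f x \<subseteq> S"
proof
  fix y assume "y \<in> orbit f x"
  then show "y \<in> S" by induct (use assms in auto)
qed

lemma finite_orbits: "finite A \<Longrightarrow> finite (orbits f A)"
  by (simp add: orbits_def)

lemma Union_orbits:
  assumes "f permutes A" "finite A"
  shows "\<Union>(orbits f A) = A"
  using permutes_self_in_orbit[OF assms] permutes_orbit_subset[OF assms(1)]
  by (auto simp: orbits_def)

lemma partition_on_orbits:
  assumes "f permutes A" "finite A"
  shows "partition_on A (orbits f A)"
proof (rule partition_onI)
  fix p q assume *: "p \<in> orbits f A" "q \<in> orbits f A" "p \<noteq> q"
  then obtain x y where "p = orbit f x" "q = orbit f y" by (auto simp: orbits_def)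
  with *(3) show "disjnt p q"
    using permutes_orbit_eq[OF assms] by (metis disjnt_iff)
next
  show "{} \<notin> orbits f A" using orbit_nonempty[of f] by (force simp: orbits_def)
qed (rule Union_orbits[OF assms])

lemma orbits_id: "orbits id A = (\<lambda>x. {x}) ` A"
  unfolding orbits_def by (intro image_cong) (auto simp: orbit_eq_singleton_iff)

text \<open>Starting at \<open>a\<close>, the new permutation follows \<open>f\<close> along the
  whole cycle of \<open>a\<close>, because this cycle avoids \<open>b\<close>. Only the closing step
  back to \<open>a\<close> changes: it now leads to \<open>b\<close>.\<close>

lemma orbit_transpose_comp_superset:
  assumes "f permutes A" "finite A" "a \<in> A" "b \<in> A" "b \<notin> orbit f a"
  shows "insert b (orbit f a) \<subseteq> orbit (transpose a b \<circ> f) a"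
proof -
  define h where "h = transpose a b \<circ> f"
  have hperm: "h permutes A"
    unfolding h_def using assms by (intro permutes_compose permutes_swap_id) auto
  have self: "a \<in> orbit h a" by (rule permutes_self_in_orbit[OF hperm assms(2)])
  have sub: "y \<in> orbit h a" if "y \<in> orbit f a" for y
    using that
  proof induct
    case base
    show ?case
    proof (cases "f a = a")
      case False
      have "f a \<noteq> b" using assms(5) orbit.base[of f a] by auto
      with False have "h a = f a" by (simp add: h_def)
      then show ?thesis using orbit.base[of h a] by simp
    qed (use self in simp)
  next
    case (step y)
    show ?case
    proof (cases "f y = a")
      case False
      have "f y \<noteq> b" using assms(5) orbit.step[OF step(1)] by auto
      with False have "h y = f y" by (simp add: h_def)
      then show ?thesis using orbit.step[OF step(2)] by simp
    qed (use self in simp)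
  qed
  \<comment> \<open>The last point of the cycle before it returns to \<open>a\<close>.\<close>
  let ?y = "inv f a"
  have fy: "f ?y = a" using assms(1) by (simp add: permutes_inverses)
  have "?y \<in> orbit f a"
    using permutes_self_in_orbit[OF assms(1,2), of ?y] permutes_orbit_step[OF assms(1,2), of ?y] fy
    by simp
  then have "h ?y \<in> orbit h a" by (intro orbit.step sub)
  with fy sub show ?thesis by (auto simp: h_def)
qed

text \<open>By the previous lemma, used for \<open>a, b\<close> and for \<open>b, a\<close>, the new
  cycle contains both old ones. It is no larger since their union is invariant, and outside the
  union nothing changes.\<close>

lemma orbit_transpose_merge:
  assumes "f permutes A" "finite A" "a \<in> A" "b \<in> A" "orbit f a \<noteq> orbit f b"
  defines "U \<equiv> orbit f a \<union> orbit f b"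
  shows "orbit (transpose a b \<circ> f) x = (if x \<in> U then U else orbit f x)"
proof -
  let ?h = "transpose a b \<circ> f"
  have h: "?h permutes A"
    using assms by (intro permutes_compose permutes_swap_id) auto
  have nb: "b \<notin> orbit f a" and na: "a \<notin> orbit f b"
    using assms(5) permutes_orbit_eq[OF assms(1,2)] by metis+
  have 1: "insert b (orbit f a) \<subseteq> orbit ?h a"
    by (rule orbit_transpose_comp_superset[OF assms(1-4) nb])
  have 2: "insert a (orbit f b) \<subseteq> orbit ?h b"
    using orbit_transpose_comp_superset[OF assms(1,2,4,3) na] by (simp add: transpose_commute)
  have ab: "orbit ?h b = orbit ?h a"
    using 1 permutes_orbit_eq[OF h assms(2)] by blast
  have inU: "f y \<in> U \<longleftrightarrow> y \<in> U" for y
    by (simp add: U_def permutes_mem_orbit_iff[OF assms(1,2)] permutes_orbit_step[OF assms(1,2)])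
  have abU: "a \<in> U" "b \<in> U"
    unfolding U_def using permutes_self_in_orbit[OF assms(1,2)] by auto
  show ?thesis
  proof (cases "x \<in> U")
    case True
    then have "x \<in> orbit ?h a" using 1 2 ab by (auto simp: U_def)
    then have "orbit ?h x = orbit ?h a" by (rule permutes_orbit_eq[OF h assms(2)])
    moreover have "orbit ?h a \<subseteq> U"
    proof (rule orbit_subset_invariant)
      show "?h ` U \<subseteq> U" using abU inU by (auto simp: transpose_def)
    qed (fact abU)
    moreover have "U \<subseteq> orbit ?h a" using 1 2 ab by (auto simp: U_def)
    ultimately show ?thesis using True by auto
  next
    case False
    have "orbit ?h x = orbit f x"
    proof (rule orbit_cong[OF permutes_self_in_orbit[OF assms(1,2)]])
      fix s assume "s \<in> orbit f x"
      then have "orbit f s = orbit f x" by (rule permutes_orbit_eq[OF assms(1,2)])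
      then have "s \<notin> U"
        using False by (simp add: U_def permutes_mem_orbit_iff[OF assms(1,2)])
      then have "f s \<notin> U" by (simp add: inU)
      then show "?h s = f s" using abU by (auto simp: transpose_def)
    qed
    then show ?thesis using False by simp
  qed
qed

text \<open>Shared bookkeeping: \<open>c\<close> assigns to each point its class, and gluing two
  classes loses one. It serves both cycles of one permutation and joint orbits of two.\<close>

lemma card_image_merge:
  assumes fin: "finite A" and ab: "a \<in> A" "b \<in> A" "c a \<noteq> c b"
    and x: "\<And>x. x \<in> A \<Longrightarrow> x \<in> c x"
    and eq: "\<And>x y. x \<in> A \<Longrightarrow> y \<in> A \<Longrightarrow> y \<in> c x \<Longrightarrow> c y = c x"
    and c': "\<And>x. x \<in> A \<Longrightarrow> c' x = (if x \<in> c a \<union> c b then c a \<union> c b else c x)"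
  shows "Suc (card (c' ` A)) = card (c ` A)"
proof -
  have 1: "c' ` A = insert (c a \<union> c b) (c ` A - {c a, c b})"
  proof (intro equalityI subsetI)
    fix S assume "S \<in> c' ` A"
    then obtain y where y: "y \<in> A" "S = c' y" by auto
    then show "S \<in> insert (c a \<union> c b) (c ` A - {c a, c b})"
      using c'[OF y(1)] x[OF y(1)] by auto
  next
    fix S assume S: "S \<in> insert (c a \<union> c b) (c ` A - {c a, c b})"
    show "S \<in> c' ` A"
    proof (cases "S = c a \<union> c b")
      case True
      then have "S = c' a" using c'[OF ab(1)] x[OF ab(1)] by auto
      then show ?thesis using ab(1) by auto
    next
      case False
      with S obtain y where y: "y \<in> A" "S = c y" "c y \<noteq> c a" "c y \<noteq> c b" by auto
      then have "y \<notin> c a \<union> c b" using eq[of a y] eq[of b y] ab by auto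
      then have "S = c' y" using c'[OF y(1)] y by auto
      then show ?thesis using y by auto
    qed
  qed
  have 2: "c a \<union> c b \<notin> c ` A - {c a, c b}"
  proof
    assume "c a \<union> c b \<in> c ` A - {c a, c b}"
    then obtain y where y: "y \<in> A" "c y = c a \<union> c b" "c y \<noteq> c a" by auto
    then have "a \<in> c y" using x[OF ab(1)] by auto
    then have "c a = c y" using eq[OF y(1) ab(1)] by simp
    with y show False by simp
  qed
  have "card (c ` A - {c a, c b}) = card (c ` A) - card {c a, c b}"
    using ab by (intro card_Diff_subset) auto
  moreover have "card {c a, c b} \<le> card (c ` A)"
    using fin ab by (intro card_mono) auto
  ultimately have "card (c ` A) = card (c ` A - {c a, c b}) + 2"
    using ab(3) by simp
  moreover have "card (c' ` A) = Suc (card (c ` A - {c a, c b}))"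
    unfolding 1 using 2 fin by (intro card_insert_disjoint) auto
  ultimately show ?thesis by simp
qed

lemma card_orbits_merge:
  assumes "f permutes A" "finite A" "a \<in> A" "b \<in> A" "orbit f a \<noteq> orbit f b"
  shows "Suc (card (orbits (transpose a b \<circ> f) A)) = card (orbits f A)"
  unfolding orbits_def
proof (rule card_image_merge[of A a b, OF assms(2-5)])
  show "orbit f y = orbit f x" if "y \<in> orbit f x" for x y
    using that by (rule permutes_orbit_eq[OF assms(1,2)])
qed (rule permutes_self_in_orbit[OF assms(1,2)], rule orbit_transpose_merge[OF assms])

text \<open>Follow \<open>f\<close> from \<open>b\<close> until it first hits \<open>a\<close>. The
  new permutation agrees with \<open>f\<close> on this stretch, except that the final step to
  \<open>a\<close> is sent back to \<open>b\<close>; so the stretch is closed and misses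
  \<open>a\<close>.\<close>

lemma orbit_transpose_split:
  assumes "f permutes A" "finite A" "a \<in> A" "b \<in> A" "a \<noteq> b" "orbit f a = orbit f b"
  shows "orbit (transpose a b \<circ> f) a \<noteq> orbit (transpose a b \<circ> f) b"
proof
  let ?h = "transpose a b \<circ> f"
  assume eq: "orbit ?h a = orbit ?h b"
  have h: "?h permutes A"
    using assms by (intro permutes_compose permutes_swap_id) auto
  have "a \<in> orbit f b" using permutes_self_in_orbit[OF assms(1,2)] assms(6) by blast
  then obtain n where "(f ^^ n) b = a" by (auto simp: orbit_altdef)
  define m where "m = (LEAST n. (f ^^ n) b = a)"
  have m: "(f ^^ m) b = a" unfolding m_def by (rule LeastI, fact)
  have less: "(f ^^ j) b \<noteq> a" if "j < m" for j
    using that not_less_Least unfolding m_def by blast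
  have m0: "m > 0" using m assms(5) by (cases m) auto
  let ?S = "{(f ^^ j) b | j. j < m}"
  \<comment> \<open>A return to \<open>b\<close> after \<open>j\<close> steps would make
    \<open>a\<close> reachable in \<open>m - j\<close> steps, against minimality.\<close>
  have nb: "(f ^^ j) b \<noteq> b" if "0 < j" "j < m" for j
  proof
    assume *: "(f ^^ j) b = b"
    have "(f ^^ m) b = (f ^^ (m - j)) ((f ^^ j) b)"
      using that by (metis add_diff_inverse_nat comp_apply funpow_add add.commute not_less_iff_gr_or_eq)
    with * m less[of "m - j"] that show False by simp
  qed
  have "orbit ?h b \<subseteq> ?S"
  proof (rule orbit_subset_invariant)
    show "b \<in> ?S" using m0 by (auto intro!: exI[of _ 0])
    show "?h ` ?S \<subseteq> ?S"
    proof safe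
      fix j assume j: "j < m"
      show "\<exists>k. ?h ((f ^^ j) b) = (f ^^ k) b \<and> k < m"
      proof (cases "Suc j = m")
        case True
        then have "f ((f ^^ j) b) = a" using m by auto
        then have "?h ((f ^^ j) b) = (f ^^ 0) b" by simp
        then show ?thesis using m0 by blast
      next
        case False
        then have "Suc j < m" using j by simp
        then have "f ((f ^^ j) b) \<noteq> a" "f ((f ^^ j) b) \<noteq> b"
          using less[of "Suc j"] nb[of "Suc j"] by auto
        then have "?h ((f ^^ j) b) = (f ^^ Suc j) b" by simp
        then show ?thesis using \<open>Suc j < m\<close> by blast
      qed
    qed
  qed
  moreover have "a \<in> orbit ?h b" using eq permutes_self_in_orbit[OF h assms(2)] by blast
  ultimately show False using less by blast
qed

lemma transpose_comp_transpose_comp: "transpose a b \<circ> (transpose a b \<circ> f) = f"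
  by (simp add: fun_eq_iff)

text \<open>Multiplying twice by the same transposition restores \<open>f\<close>, so a split is a
  merge read backwards.\<close>

lemma card_orbits_split:
  assumes "f permutes A" "finite A" "a \<in> A" "b \<in> A" "a \<noteq> b" "orbit f a = orbit f b"
  shows "card (orbits (transpose a b \<circ> f) A) = Suc (card (orbits f A))"
proof -
  have h: "transpose a b \<circ> f permutes A"
    using assms by (intro permutes_compose permutes_swap_id) auto
  from card_orbits_merge[OF h assms(2-4) orbit_transpose_split[OF assms]]
  show ?thesis by (simp only: transpose_comp_transpose_comp)
qed

lemma card_orbits_transpose_le:
  assumes "f permutes A" "finite A" "a \<in> A" "b \<in> A"
  shows "card (orbits (transpose a b \<circ> f) A) \<le> Suc (card (orbits f A))"
proof (cases "a = b")
  case False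
  show ?thesis
    using card_orbits_merge[OF assms] card_orbits_split[OF assms False]
    by (cases "orbit f a = orbit f b") auto
qed simp

text \<open>For permutations of a finite set this is the orbit of \<open>x\<close> under the group generated by
  \<open>f\<close> and \<open>g\<close>: forward images suffice.\<close>

inductive_set joint_orbit :: "('a \<Rightarrow> 'a) \<Rightarrow> ('a \<Rightarrow> 'a) \<Rightarrow> 'a \<Rightarrow> 'a set" for f g x where
  self: "x \<in> joint_orbit f g x"
| left: "y \<in> joint_orbit f g x \<Longrightarrow> f y \<in> joint_orbit f g x"
| right: "y \<in> joint_orbit f g x \<Longrightarrow> g y \<in> joint_orbit f g x"

lemma joint_orbit_least:
  assumes "x \<in> S" "f ` S \<subseteq> S" "g ` S \<subseteq> S"
  shows "joint_orbit f g x \<subseteq> S"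
proof
  fix y assume "y \<in> joint_orbit f g x"
  then show "y \<in> S" by induct (use assms in auto)
qed

lemma joint_orbit_subset:
  assumes "f permutes A" "g permutes A" "x \<in> A"
  shows "joint_orbit f g x \<subseteq> A"
  using assms by (intro joint_orbit_least) (auto simp: permutes_image)

lemma joint_orbit_invariant:
  "f ` joint_orbit f g x \<subseteq> joint_orbit f g x" "g ` joint_orbit f g x \<subseteq> joint_orbit f g x"
  by (auto intro: joint_orbit.intros)

text \<open>On a finite set an injective self-map is onto. This stands in for closure under
  inverses, since \<open>joint_orbit\<close> is generated by forward images only.\<close>

lemma invariant_in_iff:
  assumes "inj f" "finite S" "f ` S \<subseteq> S"
  shows "f y \<in> S \<longleftrightarrow> y \<in> S"
proof -
  have "f ` S = S" using assms by (metis endo_inj_surj inj_on_subset subset_UNIV)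
  then show ?thesis using assms(1) by (metis image_eqI inj_image_mem_iff)
qed

text \<open>The point is symmetry: if \<open>x\<close> were outside the joint orbit of
  \<open>y\<close>, the complement of that orbit would be an invariant set containing
  \<open>x\<close>, hence also containing \<open>y\<close>.\<close>

lemma joint_orbit_eq:
  assumes "f permutes A" "g permutes A" "finite A" "x \<in> A" "y \<in> joint_orbit f g x"
  shows "joint_orbit f g y = joint_orbit f g x"
proof -
  have yA: "y \<in> A" using joint_orbit_subset[OF assms(1,2,4)] assms(5) by blast
  have sub: "joint_orbit f g y \<subseteq> joint_orbit f g x"
    by (rule joint_orbit_least[OF assms(5) joint_orbit_invariant])
  have fin: "finite (joint_orbit f g y)"
    using joint_orbit_subset[OF assms(1,2) yA] assms(3) by (rule finite_subset)
  have "x \<in> joint_orbit f g y"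
  proof (rule ccontr)
    assume "x \<notin> joint_orbit f g y"
    have "joint_orbit f g x \<subseteq> - joint_orbit f g y"
    proof (rule joint_orbit_least)
      show "f ` (- joint_orbit f g y) \<subseteq> - joint_orbit f g y"
        using invariant_in_iff[OF permutes_inj[OF assms(1)] fin joint_orbit_invariant(1)] by auto
      show "g ` (- joint_orbit f g y) \<subseteq> - joint_orbit f g y"
        using invariant_in_iff[OF permutes_inj[OF assms(2)] fin joint_orbit_invariant(2)] by auto
    qed (use \<open>x \<notin> _\<close> in simp)
    with assms(5) joint_orbit.self[of y f g] show False by blast
  qed
  then have "joint_orbit f g x \<subseteq> joint_orbit f g y"
    by (rule joint_orbit_least) (rule joint_orbit_invariant)+
  with sub show ?thesis by auto
qed

lemma orbit_subset_joint_orbit: "orbit f x \<subseteq> joint_orbit f g x"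
proof
  fix y assume "y \<in> orbit f x"
  then show "y \<in> joint_orbit f g x" by induct (auto intro: joint_orbit.intros)
qed

lemma orbit_comp_subset_joint_orbit: "orbit (f \<circ> g) x \<subseteq> joint_orbit f g x"
proof
  fix y assume "y \<in> orbit (f \<circ> g) x"
  then show "y \<in> joint_orbit f g x" by induct (auto intro: joint_orbit.intros)
qed

lemma joint_orbit_id_left:
  assumes "g permutes A" "finite A"
  shows "joint_orbit id g x = orbit g x"
proof
  show "joint_orbit id g x \<subseteq> orbit g x"
    by (rule joint_orbit_least) (auto intro: permutes_self_in_orbit[OF assms] orbit.step)
  show "orbit g x \<subseteq> joint_orbit id g x"
    using orbit_comp_subset_joint_orbit[of id g x] by simp
qed

lemma joint_orbit_id_right:
  assumes "f permutes A" "finite A"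
  shows "joint_orbit f id x = orbit f x"
proof
  show "joint_orbit f id x \<subseteq> orbit f x"
    by (rule joint_orbit_least) (auto intro: permutes_self_in_orbit[OF assms] orbit.step)
qed (rule orbit_subset_joint_orbit)

section \<open>The genus inequality\<close>

text \<open>As \<open>b = f a\<close>, a joint orbit of \<open>f\<close> and \<open>g\<close> never
  separates \<open>a\<close> from \<open>b\<close>, so it is closed under the shortened permutation.
  Going back to \<open>f\<close> merely adds the link between \<open>a\<close> and
  \<open>b\<close>.\<close>

lemma joint_orbit_transpose:
  assumes f: "f permutes A" and g: "g permutes A" and fin: "finite A"
    and a: "a \<in> A" and b: "b = f a" and x: "x \<in> A"
  defines "K \<equiv> joint_orbit (transpose a b \<circ> f) g"
  shows "joint_orbit f g x = (if x \<in> K a \<union> K b then K a \<union> K b else K x)"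
proof -
  define h where "h = transpose a b \<circ> f"
  have bA: "b \<in> A" using a b f by (simp add: permutes_in_image)
  have h: "h permutes A"
    unfolding h_def using f a bA by (intro permutes_compose permutes_swap_id)
  have K: "K = joint_orbit h g" by (simp add: K_def h_def)
  have f_h: "f y = transpose a b (h y)" for y by (simp add: h_def)
  have fin': "finite (joint_orbit f g y)" if "y \<in> A" for y
    using joint_orbit_subset[OF f g that] fin by (rule finite_subset)
  have KK: "K z = K y" if "y \<in> A" "z \<in> K y" for y z
    using that joint_orbit_eq[OF h g fin] by (simp add: K)
  have JJ: "joint_orbit f g z = joint_orbit f g y" if "y \<in> A" "z \<in> joint_orbit f g y" for y z
    using that joint_orbit_eq[OF f g fin] by simp
  have sub: "K y \<subseteq> joint_orbit f g y" if y: "y \<in> A" for y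
    unfolding K
  proof (rule joint_orbit_least[OF joint_orbit.self])
    have "b \<in> joint_orbit f g y \<longleftrightarrow> a \<in> joint_orbit f g y"
      unfolding b by (rule invariant_in_iff[OF permutes_inj[OF f] fin'[OF y] joint_orbit_invariant(1)])
    then show "h ` joint_orbit f g y \<subseteq> joint_orbit f g y"
      by (auto simp: h_def transpose_def intro: joint_orbit.intros)
  qed (rule joint_orbit_invariant)
  have ab: "joint_orbit f g b = joint_orbit f g a"
    by (rule JJ[OF a]) (auto simp: b intro: joint_orbit.intros)
  show ?thesis
  proof (cases "x \<in> K a \<union> K b")
    case True
    then have "x \<in> joint_orbit f g a" using sub[OF a] sub[OF bA] ab by auto
    then have "joint_orbit f g x = joint_orbit f g a" by (rule JJ[OF a])
    moreover have "joint_orbit f g a \<subseteq> K a \<union> K b"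
    proof (rule joint_orbit_least)
      have "a \<in> K a" "b \<in> K b" by (auto simp: K intro: joint_orbit.self)
      moreover have "h y \<in> K a \<union> K b" if "y \<in> K a \<union> K b" for y
        using that by (auto simp: K intro: joint_orbit.intros)
      ultimately show "f ` (K a \<union> K b) \<subseteq> K a \<union> K b"
        by (auto simp: f_h transpose_def)
    qed (auto simp: K intro: joint_orbit.intros)
    ultimately show ?thesis using True sub[OF a] sub[OF bA] ab by auto
  next
    case False
    have "x \<in> K x" by (simp add: K joint_orbit.self)
    then have nab: "a \<notin> K x" "b \<notin> K x"
      using KK[OF x, of a] KK[OF x, of b] False by blast+
    have "joint_orbit f g x \<subseteq> K x"
    proof (rule joint_orbit_least)
      have "h y \<in> K x" if "y \<in> K x" for y using that by (simp add: K joint_orbit.left)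
      then show "f ` K x \<subseteq> K x" using nab by (auto simp: f_h transpose_def)
    qed (simp_all add: K joint_orbit.self joint_orbit_invariant)
    then show ?thesis using False sub[OF x] by auto
  qed
qed

text \<open>This is nonnegativity of the genus on every joint orbit. Induct on the moved points:
  with \<open>b = f a \<noteq> a\<close>, the permutation \<open>h = transpose a b \<circ> f\<close>
  fixes \<open>a\<close> and has one more cycle than \<open>f\<close>. If \<open>a\<close> and
  \<open>b\<close> are joined by \<open>h\<close> and \<open>g\<close>, the joint orbits stay and
  \<open>f \<circ> g\<close> gains at most one cycle over \<open>h \<circ> g\<close>. Otherwise two
  joint orbits and two cycles of \<open>h \<circ> g\<close> merge, so both sides drop by two. For
  \<open>f = id\<close> equality holds.\<close>

theorem genus_inequality:
  assumes "f permutes A" "g permutes A" "finite A"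
  shows "card (orbits f A) + card (orbits g A) + card (orbits (f \<circ> g) A)
    \<le> card A + 2 * card (joint_orbit f g ` A)"
  using assms(1)
proof (induction "card {x. f x \<noteq> x}" arbitrary: f rule: less_induct)
  case less
  show ?case
  proof (cases "f = id")
    case True
    have "card (orbits id A) = card A"
      by (simp add: orbits_id card_image)
    moreover have "joint_orbit id g ` A = orbits g A"
      unfolding orbits_def using joint_orbit_id_left[OF assms(2,3)] by simp
    ultimately show ?thesis using True by simp
  next
    case False
    then obtain a where a: "f a \<noteq> a" by (auto simp: fun_eq_iff)
    define b where "b = f a"
    have aA: "a \<in> A" using a less.prems by (auto dest: permutes_not_in)
    then have bA: "b \<in> A" using less.prems by (simp add: b_def permutes_in_image)
    have ab: "a \<noteq> b" using a by (simp add: b_def)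
    define h where "h = transpose a b \<circ> f"
    have h: "h permutes A"
      unfolding h_def using less.prems aA bA by (intro permutes_compose permutes_swap_id)
    have hg: "h \<circ> g permutes A" using h assms(2) by (intro permutes_compose)
    have fg: "f \<circ> g = transpose a b \<circ> (h \<circ> g)" by (simp add: h_def fun_eq_iff)
    have "finite {x. f x \<noteq> x}"
      by (rule finite_subset[OF _ assms(3)]) (use less.prems in \<open>auto dest: permutes_not_in\<close>)
    moreover have "{x. h x \<noteq> x} \<subset> {x. f x \<noteq> x}"
    proof (rule psubsetI)
      have "f b \<noteq> b" using ab inj_eq[OF permutes_inj[OF less.prems], of b a] by (simp add: b_def)
      then have "h x = x" if "f x = x" for x
        using that a by (auto simp: h_def transpose_def)
      then show "{x. h x \<noteq> x} \<subseteq> {x. f x \<noteq> x}" by blast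
      have "h a = a" by (simp add: h_def b_def)
      with a show "{x. h x \<noteq> x} \<noteq> {x. f x \<noteq> x}" by blast
    qed
    ultimately have "card {x. h x \<noteq> x} < card {x. f x \<noteq> x}" by (rule psubset_card_mono)
    from less.hyps[OF this h]
    have IH: "card (orbits h A) + card (orbits g A) + card (orbits (h \<circ> g) A)
        \<le> card A + 2 * card (joint_orbit h g ` A)" .
    have "orbit f a = orbit f b"
      unfolding b_def using permutes_orbit_step[OF less.prems assms(3)] by simp
    then have ch: "card (orbits h A) = Suc (card (orbits f A))"
      unfolding h_def using less.prems aA bA ab assms(3) by (intro card_orbits_split) auto
    note J = joint_orbit_transpose[OF less.prems assms(2,3) aA b_def, folded h_def]
    note KK = joint_orbit_eq[OF h assms(2,3)]
    show ?thesis
    proof (cases "joint_orbit h g a = joint_orbit h g b")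
      case True
      have "joint_orbit f g x = joint_orbit h g x" if "x \<in> A" for x
        using J[OF that] KK[OF aA, of x] True by auto
      then have "joint_orbit f g ` A = joint_orbit h g ` A" by simp
      moreover have "card (orbits (f \<circ> g) A) \<le> Suc (card (orbits (h \<circ> g) A))"
        unfolding fg using hg aA bA assms(3) by (intro card_orbits_transpose_le)
      ultimately show ?thesis using IH ch by simp
    next
      case False
      have "Suc (card (joint_orbit f g ` A)) = card (joint_orbit h g ` A)"
        by (rule card_image_merge[OF assms(3) aA bA False joint_orbit.self KK J])
      moreover have "orbit (h \<circ> g) a \<noteq> orbit (h \<circ> g) b"
        using False KK[OF aA, of b] orbit_comp_subset_joint_orbit[of h g a]
          permutes_self_in_orbit[OF hg assms(3), of b] by auto
      then have "Suc (card (orbits (f \<circ> g) A)) = card (orbits (h \<circ> g) A)"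
        unfolding fg using hg aA bA assms(3) by (intro card_orbits_merge)
      ultimately show ?thesis using IH ch by simp
    qed
  qed
qed

lemma card_orbits_eq_1_iff:
  assumes "f permutes A" "finite A" "x \<in> A"
  shows "card (orbits f A) = 1 \<longleftrightarrow> orbit f x = A"
proof
  assume "card (orbits f A) = 1"
  then obtain U where U: "orbits f A = {U}" by (auto simp: card_1_singleton_iff)
  then have "U = A" using Union_orbits[OF assms(1,2)] by simp
  moreover have "orbit f x \<in> orbits f A" using assms(3) by (simp add: orbits_def)
  ultimately show "orbit f x = A" using U by simp
next
  assume *: "orbit f x = A"
  then have "orbit f y = A" if "y \<in> A" for y
    using permutes_orbit_eq[OF assms(1,2)] that by metis
  then have "orbits f A = {A}" using assms(3) by (auto simp: orbits_def)
  then show "card (orbits f A) = 1" by simp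
qed

lemma genus_inequality_transitive:
  assumes "f permutes A" "g permutes A" "finite A" "x \<in> A" "joint_orbit f g x = A"
  shows "card (orbits f A) + card (orbits g A) + card (orbits (f \<circ> g) A) \<le> card A + 2"
proof -
  have "joint_orbit f g y = A" if "y \<in> A" for y
    using joint_orbit_eq[OF assms(1-4)] that assms(5) by metis
  then have "joint_orbit f g ` A = {A}" using assms(4) by auto
  then show ?thesis using genus_inequality[OF assms(1-3)] by simp
qed

section \<open>Invariance of cycle counts under conjugation\<close>

lemma orbit_conj:
  assumes "f permutes A" "finite A" "bij s"
  shows "orbit (s \<circ> f \<circ> inv s) (s x) = s ` orbit f x"
  by (rule orbit_inverse[symmetric, OF permutes_self_in_orbit[OF assms(1,2)]])
    (simp add: bij_is_inj[OF assms(3)])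

lemma orbits_conj:
  assumes "f permutes A" "finite A" "s permutes A"
  shows "orbits (s \<circ> f \<circ> inv s) A = (`) s ` orbits f A"
proof -
  have "orbits (s \<circ> f \<circ> inv s) A = orbit (s \<circ> f \<circ> inv s) ` s ` A"
    by (simp add: orbits_def permutes_image[OF assms(3)])
  also have "\<dots> = (`) s ` orbits f A"
    unfolding orbits_def image_image
    by (intro image_cong refl orbit_conj[OF assms(1,2) permutes_bij[OF assms(3)]])
  finally show ?thesis .
qed

lemma card_orbits_conj:
  assumes "f permutes A" "finite A" "s permutes A"
  shows "card (orbits (s \<circ> f \<circ> inv s) A) = card (orbits f A)"
  unfolding orbits_conj[OF assms]
  using inj_on_image_Pow[OF permutes_inj[OF assms(3)]] by (auto intro!: card_image intro: inj_on_subset)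

section \<open>Partitions as permutations\<close>

text \<open>The cyclic successor of \<open>x\<close> in \<open>V\<close> in increasing order,
  wrapping from the maximum to the minimum. It describes increasing cycles by order alone, so that
  lists can be left behind.\<close>

definition is_next :: "nat set \<Rightarrow> nat \<Rightarrow> nat \<Rightarrow> bool" where
  "is_next V x y \<longleftrightarrow> y \<in> V \<and>
     (x < y \<and> (\<forall>z\<in>V. x < z \<longrightarrow> y \<le> z) \<or> (\<forall>z\<in>V. z \<le> x) \<and> (\<forall>z\<in>V. y \<le> z))"

lemma is_next_unique: "is_next V x y \<Longrightarrow> is_next V x z \<Longrightarrow> y = z"
  by (auto simp: is_next_def intro: order_antisym)

lemma cycle_of_sorted_list:
  assumes "finite V" "x \<in> V"
  shows "is_next V x (cycle_of_list (sorted_list_of_set V) x)"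
proof -
  define xs where "xs = sorted_list_of_set V"
  have xs: "set xs = V" "sorted_wrt (<) xs" "distinct xs" using assms(1) by (auto simp: xs_def)
  have lt: "xs ! i < xs ! j \<longleftrightarrow> i < j" if "i < length xs" "j < length xs" for i j
    using sorted_wrt_nth_less[OF xs(2), of i j] sorted_wrt_nth_less[OF xs(2), of j i] that
    by (cases i j rule: linorder_cases) auto
  obtain k where k: "k < length xs" "x = xs ! k" using assms(2) xs(1) by (metis in_set_conv_nth)
  have "map (cycle_of_list xs) xs = rotate1 xs"
    using cyclic_rotation[OF xs(3), of 1] by simp
  then have "cycle_of_list xs x = rotate1 xs ! k" using k by (metis nth_map)
  also have "\<dots> = xs ! (Suc k mod length xs)" using k(1) by (rule nth_rotate1)
  finally have eq: "cycle_of_list xs x = xs ! (Suc k mod length xs)" .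
  have all: "(\<forall>z\<in>V. Q z) \<longleftrightarrow> (\<forall>i<length xs. Q (xs ! i))" for Q
    unfolding xs(1)[symmetric] by (metis in_set_conv_nth)
  have le: "xs ! i \<le> xs ! j \<longleftrightarrow> i \<le> j" if "i < length xs" "j < length xs" for i j
    using lt[OF that(2,1)] by (simp add: not_less[symmetric])
  show ?thesis
  proof (cases "Suc k = length xs")
    case True
    then have "xs ! 0 \<in> V" using xs(1) k(1) by (metis gr_implies_not0 length_greater_0_conv list.size(3) nth_mem)
    moreover have "xs ! 0 \<le> xs ! i" "xs ! i \<le> xs ! k" if "i < length xs" for i
      using le[of 0 i] le[of i k] that k(1) True by (cases xs, auto)+
    ultimately show ?thesis
      using True k eq unfolding is_next_def all xs_def[symmetric] by simp
  next
    case False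
    then have "Suc k < length xs" using k by simp
    moreover from this have "xs ! Suc k \<in> V" using xs(1) by auto
    ultimately show ?thesis
      using k eq unfolding is_next_def all xs_def[symmetric] by (auto simp: le lt)
  qed
qed

text \<open>The walk climbs until it must wrap to the minimum of \<open>V\<close>; from there every
  element is the successor of the largest element below it.\<close>

lemma orbit_is_next:
  assumes fin: "finite V" and nx: "\<And>y. y \<in> V \<Longrightarrow> is_next V y (f y)" and x: "x \<in> V"
  shows "orbit f x = V"
proof
  show sub: "orbit f x \<subseteq> V"
    by (rule orbit_subset_invariant[OF x]) (use nx in \<open>auto simp: is_next_def\<close>)
  then have fin': "finite (orbit f x)" using fin by (rule finite_subset)
  \<comment> \<open>The successor of the largest visited point is visited too, so it cannot be
    larger: the wrapping case of \<open>is_next\<close> applies and \<open>f M\<close> is the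
    minimum of \<open>V\<close>.\<close>
  define M where "M = Max (orbit f x)"
  have M: "M \<in> orbit f x" unfolding M_def by (rule Max_in[OF fin' orbit_nonempty])
  then have fM: "f M \<in> orbit f x" by (rule orbit.step)
  then have "f M \<le> M" unfolding M_def using fin' by simp
  then have min: "\<forall>z\<in>V. f M \<le> z" using nx[of M] M sub by (auto simp: is_next_def)
  show "V \<subseteq> orbit f x"
  proof
    fix z assume "z \<in> V"
    then show "z \<in> orbit f x"
    proof (induction z rule: less_induct)
      case (less z)
      show ?case
      proof (cases "z = f M")
        case False
        define W where "W = {y \<in> V. y < z}"
        have "f M < z" "f M \<in> V" using min less.prems False fM sub by auto
        then have W: "finite W" "W \<noteq> {}" using fin by (auto simp: W_def)
        define w where "w = Max W"
        have wW: "w \<in> W" unfolding w_def by (rule Max_in[OF W])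
        have wmax: "y \<le> w" if "y \<in> V" "y < z" for y
          using that W(1) by (simp add: w_def W_def)
        have "w \<in> orbit f x" using wW less.IH by (auto simp: W_def)
        then have fw: "f w \<in> orbit f x" by (rule orbit.step)
        have "is_next V w (f w)" using wW nx by (auto simp: W_def)
        then have "f w \<in> V" "w < f w" "f w \<le> z"
          using wW less.prems by (auto simp: is_next_def W_def)
        moreover from this have "\<not> f w < z"
          using wmax[OF \<open>f w \<in> V\<close>] by linarith
        ultimately have "f w = z" by simp
        with fw show ?thesis by simp
      qed (use fM in simp)
    qed
  qed
qed

section \<open>The full cycle and the permutation of a partition\<close>

definition full_cycle :: "nat \<Rightarrow> nat \<Rightarrow> nat" where
  "full_cycle n = cycle_of_list [1..<Suc n]"

lemma full_cycle_permutes: "full_cycle n permutes {1..n}"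
  using cycle_permutes[of "[1..<Suc n]"] by (simp add: full_cycle_def atLeastLessThanSuc_atLeastAtMost del: upt_Suc)

lemma full_cycle_next:
  assumes "i \<in> {1..n}"
  shows "is_next {1..n} i (full_cycle n i)"
proof -
  have "[1..<Suc n] = sorted_list_of_set {1..n}"
    by (simp add: atLeastLessThanSuc_atLeastAtMost[symmetric] del: upt_Suc)
  then show ?thesis using cycle_of_sorted_list[OF _ assms] by (simp add: full_cycle_def del: upt_Suc)
qed

lemma full_cycle_apply:
  assumes "i \<in> {1..n}"
  shows "full_cycle n i = (if i = n then 1 else Suc i)"
  by (rule is_next_unique[OF full_cycle_next[OF assms]]) (use assms in \<open>auto simp: is_next_def\<close>)

lemma orbit_full_cycle:
  assumes "i \<in> {1..n}"
  shows "orbit (full_cycle n) i = {1..n}"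
  by (rule orbit_is_next[OF _ full_cycle_next assms]) auto

lemma partition_perm_next:
  assumes "partition_on A \<pi>" "finite A" "V \<in> \<pi>" "x \<in> V"
  shows "is_next V x (partition_perm \<pi> x)"
proof -
  have "(THE V. V \<in> \<pi> \<and> x \<in> V) = V"
    using assms partition_onD2[OF assms(1)] by (intro the_equality) (auto dest: disjointD)
  moreover have "x \<in> \<Union>\<pi>" using assms by auto
  moreover have "finite V" using assms partition_onD1 by (metis Sup_upper finite_subset)
  ultimately show ?thesis using cycle_of_sorted_list[of V x] assms(4) by (simp add: partition_perm_def)
qed

lemma orbit_partition_perm:
  assumes "partition_on A \<pi>" "finite A" "V \<in> \<pi>" "x \<in> V"
  shows "orbit (partition_perm \<pi>) x = V"
proof (rule orbit_is_next[OF _ _ assms(4)])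
  show "finite V" using assms partition_onD1 by (metis Sup_upper finite_subset)
qed (rule partition_perm_next[OF assms(1-3)])

text \<open>Every point lies in its own orbit and is therefore a value; injectivity follows by
  counting.\<close>

lemma partition_perm_permutes:
  assumes "partition_on A \<pi>" "finite A"
  shows "partition_perm \<pi> permutes A"
proof (rule bij_imp_permutes)
  have U: "\<Union>\<pi> = A" using partition_onD1[OF assms(1)] by simp
  have block: "partition_perm \<pi> x \<in> V" if "V \<in> \<pi>" "x \<in> V" for x V
    using partition_perm_next[OF assms that] by (simp add: is_next_def)
  have "partition_perm \<pi> ` A = A"
  proof
    show "partition_perm \<pi> ` A \<subseteq> A" using block U by auto
    show "A \<subseteq> partition_perm \<pi> ` A"
    proof
      fix y assume "y \<in> A"
      then obtain V where V: "V \<in> \<pi>" "y \<in> V" using U by auto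
      then have y: "y \<in> orbit (partition_perm \<pi>) y" using orbit_partition_perm[OF assms] by simp
      have "orbit (partition_perm \<pi>) y \<subseteq> partition_perm \<pi> ` A"
      proof
        fix z assume "z \<in> orbit (partition_perm \<pi>) y"
        then show "z \<in> partition_perm \<pi> ` A"
          by cases (use V U orbit_partition_perm[OF assms V] in auto)
      qed
      with y show "y \<in> partition_perm \<pi> ` A" by blast
    qed
  qed
  then show "bij_betw (partition_perm \<pi>) A A"
    using assms(2) by (metis bij_betw_def eq_card_imp_inj_on)
  show "partition_perm \<pi> x = x" if "x \<notin> A" for x
    using that U by (simp add: partition_perm_def)
qed

lemma orbits_partition_perm:
  assumes "partition_on A \<pi>" "finite A"
  shows "orbits (partition_perm \<pi>) A = \<pi>"
proof (intro equalityI subsetI)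
  fix V assume "V \<in> orbits (partition_perm \<pi>) A"
  then obtain x where x: "x \<in> A" "V = orbit (partition_perm \<pi>) x" by (auto simp: orbits_def)
  then obtain W where "W \<in> \<pi>" "x \<in> W" using partition_onD1[OF assms(1)] by auto
  then show "V \<in> \<pi>" using orbit_partition_perm[OF assms] x by simp
next
  fix V assume V: "V \<in> \<pi>"
  then obtain x where x: "x \<in> V" using partition_onD3[OF assms(1)] by (metis ex_in_conv)
  then have "x \<in> A" using V partition_onD1[OF assms(1)] by auto
  then show "V \<in> orbits (partition_perm \<pi>) A"
    using orbit_partition_perm[OF assms V x] by (auto simp: orbits_def)
qed

lemma kreweras_eq_orbits: "kreweras n \<pi> = orbits (inv (partition_perm \<pi>) \<circ> full_cycle n) {1..n}"
  by (simp only: kreweras_def orbits_def full_cycle_def)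

section \<open>Noncrossing partitions as geodesics\<close>

declare One_nat_def [simp del]  \<comment> \<open>the simplifier would turn \<open>{1..n}\<close> into \<open>{Suc 0..n}\<close>\<close>

lemma noncrossing_partitions_iff:
  "\<pi> \<in> noncrossing_partitions n \<longleftrightarrow> partition_on {1..n} \<pi> \<and>
     (\<forall>V\<in>\<pi>. \<forall>W\<in>\<pi>. \<forall>i\<in>V. \<forall>k\<in>V. \<forall>j\<in>W. \<forall>l\<in>W. i < j \<longrightarrow> j < k \<longrightarrow> k < l \<longrightarrow> V = W)"
  unfolding noncrossing_partitions_def set_partitions_def by blast

text \<open>The only step of the full cycle that leaves this arc goes from \<open>r - 1\<close> to
  \<open>r\<close>, and the transposition redirects it to \<open>p\<close>.\<close>

lemma orbit_transpose_full_cycle: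
  assumes "p \<in> {1..n}" "r \<in> {1..n}" "p < r" "c \<in> {p..<r}"
  shows "orbit (transpose p r \<circ> full_cycle n) c \<subseteq> {p..<r}"
proof (rule orbit_subset_invariant[OF assms(4)])
  have "full_cycle n y = Suc y" if "y \<in> {p..<r}" for y
    using full_cycle_apply[of y n] that assms(1,2) by auto
  then show "(transpose p r \<circ> full_cycle n) ` {p..<r} \<subseteq> {p..<r}"
    using assms(3) by (auto simp: transpose_def)
qed

text \<open>On the left, \<open>(c d)(a b)\<close> splits two cycles of \<open>f\<close>; on the right it splits
  \<open>full_cycle n\<close> and glues the two parts, so the product stays transitive and the genus
  inequality is violated.\<close>

lemma geodesic_no_split_merge:
  assumes f: "f permutes {1..n}"
    and geo: "card (orbits f {1..n}) + card (orbits (inv f \<circ> full_cycle n) {1..n}) = Suc n"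
    and ab: "a \<in> {1..n}" "b \<in> {1..n}" "a < b" "orbit f a = orbit f b"
    and cd: "c \<in> {1..n}" "d \<in> {1..n}" "c \<noteq> d"
    and split: "orbit (transpose a b \<circ> f) c = orbit (transpose a b \<circ> f) d"
    and sep: "c \<in> {a..<b} \<longleftrightarrow> d \<notin> {a..<b}"
  shows False
proof -
  let ?A = "{1..n}" and ?\<gamma> = "full_cycle n"
  define u where "u = transpose c d \<circ> transpose a b"
  define g where "g = inv f \<circ> ?\<gamma>"
  note \<gamma> = full_cycle_permutes[of n]
  have g: "g permutes ?A" unfolding g_def by (rule permutes_compose[OF \<gamma> permutes_inv[OF f]])
  have tab: "transpose a b permutes ?A" and tcd: "transpose c d permutes ?A"
    using ab cd by (auto intro!: permutes_swap_id)
  have u: "u permutes ?A" unfolding u_def by (rule permutes_compose[OF tab tcd])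
  have uf: "u \<circ> f permutes ?A" by (rule permutes_compose[OF f u])
  have tf: "transpose a b \<circ> f permutes ?A" by (rule permutes_compose[OF f tab])
  have t\<gamma>: "transpose a b \<circ> ?\<gamma> permutes ?A" by (rule permutes_compose[OF \<gamma> tab])
  have u\<gamma>: "u \<circ> ?\<gamma> permutes ?A" by (rule permutes_compose[OF \<gamma> u])
  have "card (orbits (u \<circ> f) ?A) = Suc (card (orbits (transpose a b \<circ> f) ?A))"
    unfolding u_def o_assoc[symmetric] by (rule card_orbits_split[OF tf _ cd split]) simp
  also have "card (orbits (transpose a b \<circ> f) ?A) = Suc (card (orbits f ?A))"
    by (rule card_orbits_split[OF f _ ab(1,2) _ ab(4)]) (use ab in auto)
  finally have cf: "card (orbits (u \<circ> f) ?A) = Suc (Suc (card (orbits f ?A)))" .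
  have "orbit (transpose a b \<circ> ?\<gamma>) c \<noteq> orbit (transpose a b \<circ> ?\<gamma>) d"
    using orbit_transpose_full_cycle[OF ab(1-3), of c] orbit_transpose_full_cycle[OF ab(1-3), of d]
      permutes_self_in_orbit[OF t\<gamma> finite_atLeastAtMost, of c]
      permutes_self_in_orbit[OF t\<gamma> finite_atLeastAtMost, of d] sep
    by blast
  then have "Suc (card (orbits (u \<circ> ?\<gamma>) ?A)) = card (orbits (transpose a b \<circ> ?\<gamma>) ?A)"
    unfolding u_def o_assoc[symmetric] by (intro card_orbits_merge[OF t\<gamma> _ cd(1,2)]) simp_all
  also have "\<dots> = Suc (card (orbits ?\<gamma> ?A))"
    using ab orbit_full_cycle[OF ab(1)] orbit_full_cycle[OF ab(2)]
    by (intro card_orbits_split[OF \<gamma>]) auto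
  also have "card (orbits ?\<gamma> ?A) = 1"
    using card_orbits_eq_1_iff[OF \<gamma> _ ab(1)] orbit_full_cycle[OF ab(1)] by simp
  finally have "Suc (card (orbits (u \<circ> ?\<gamma>) ?A)) = Suc 1" .
  then have c\<gamma>: "card (orbits (u \<circ> ?\<gamma>) ?A) = 1" by (rule Suc_inject)
  have prod: "(u \<circ> f) \<circ> g = u \<circ> ?\<gamma>"
    by (simp add: g_def fun_eq_iff permutes_inverses[OF f])
  have "orbit (u \<circ> ?\<gamma>) a = ?A"
    using card_orbits_eq_1_iff[OF u\<gamma> _ ab(1)] c\<gamma> by simp
  then have "joint_orbit (u \<circ> f) g a = ?A"
    using orbit_comp_subset_joint_orbit[of "u \<circ> f" g a] joint_orbit_subset[OF uf g ab(1)]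
    unfolding prod by auto
  \<comment> \<open>The three cycle counts add up to \<open>n + 4\<close>: two splits raise
    \<open>n + 1\<close> to \<open>n + 3\<close>, and the product has one cycle. The bound is
    \<open>n + 2\<close>.\<close>
  from genus_inequality_transitive[OF uf g _ ab(1) this] show False
    using cf c\<gamma> geo unfolding prod by (simp add: g_def)
qed

text \<open>For a crossing \<open>i < j < k < l\<close>, cut with \<open>transpose i k\<close> and
  then with \<open>transpose j l\<close>. The first cut does not touch the cycle \<open>W\<close>,
  so the second one splits it, while \<open>j\<close> and \<open>l\<close> lie on different arcs of
  the full cycle.\<close>

lemma geodesic_orbits_noncrossing:
  assumes f: "f permutes {1..n}"
    and geo: "card (orbits f {1..n}) + card (orbits (inv f \<circ> full_cycle n) {1..n}) = Suc n"
  shows "orbits f {1..n} \<in> noncrossing_partitions n"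
  unfolding noncrossing_partitions_iff
proof (intro conjI ballI impI partition_on_orbits[OF f])
  fix V W i j k l
  assume VW: "V \<in> orbits f {1..n}" "W \<in> orbits f {1..n}"
    and mem: "i \<in> V" "k \<in> V" "j \<in> W" "l \<in> W" and less: "i < j" "j < k" "k < l"
  note mem_iff = permutes_mem_orbit_iff[OF f finite_atLeastAtMost]
  have V: "V = orbit f i" "V = orbit f k" and W: "W = orbit f j" "W = orbit f l"
    using VW mem by (auto simp: orbits_def mem_iff)
  have in_A: "i \<in> {1..n}" "k \<in> {1..n}" "j \<in> {1..n}" "l \<in> {1..n}"
    using VW mem Union_orbits[OF f finite_atLeastAtMost] by blast+
  show "V = W"
  proof (rule ccontr)
    assume "V \<noteq> W"
    have ik: "i \<notin> W" "k \<notin> W" using \<open>V \<noteq> W\<close> V W(1) mem_iff by metis+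
    have "orbit (transpose i k \<circ> f) j = orbit f j"
    proof (rule orbit_cong[OF permutes_self_in_orbit[OF f finite_atLeastAtMost]])
      fix s assume "s \<in> orbit f j"
      then have "f s \<in> W" unfolding W(1) by (rule orbit.step)
      then have "f s \<noteq> i" "f s \<noteq> k" using ik by blast+
      then show "(transpose i k \<circ> f) s = f s" by simp
    qed
    then have "l \<in> orbit (transpose i k \<circ> f) j" using mem(4) W(1) by simp
    then have "orbit (transpose i k \<circ> f) j = orbit (transpose i k \<circ> f) l"
      by (rule permutes_orbit_eq[OF permutes_compose[OF f permutes_swap_id[OF in_A(1,2)]]
          finite_atLeastAtMost, symmetric])
    then show False
      using V less by (intro geodesic_no_split_merge[OF f geo in_A(1,2) _ _ in_A(3,4)]) auto
  qed
qed simp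

text \<open>Cutting with \<open>transpose x (f x)\<close> isolates \<open>x\<close> and keeps the
  rest of its cycle together. A further point \<open>y\<close> of that rest can then be cut off from
  \<open>f x\<close>; by \<open>geodesic_no_split_merge\<close> the two must lie on the same arc
  between \<open>x\<close> and \<open>f x\<close>, which says that \<open>f x\<close> is the cyclic
  successor.\<close>

lemma geodesic_is_next:
  assumes f: "f permutes {1..n}"
    and geo: "card (orbits f {1..n}) + card (orbits (inv f \<circ> full_cycle n) {1..n}) = Suc n"
    and x: "x \<in> {1..n}"
  shows "is_next (orbit f x) x (f x)"
proof (cases "f x = x")
  case True
  then have "orbit f x = {x}" by (simp add: orbit_eq_singleton_iff)
  then show ?thesis using True by (simp add: is_next_def)
next
  case False
  let ?t = "transpose x (f x)"
  have fin: "finite {1..n}" by simp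
  have fx: "f x \<in> {1..n}" using permutes_in_image[OF f] x by blast
  have eq: "orbit f x = orbit f (f x)" using permutes_orbit_step[OF f fin] by simp
  have tf: "?t \<circ> f permutes {1..n}"
    using f x fx by (intro permutes_compose permutes_swap_id)
  have "orbit f x = orbit (?t \<circ> f) x \<union> orbit (?t \<circ> f) (f x)"
    using orbit_transpose_merge[OF tf fin x fx orbit_transpose_split[OF f fin x fx False[symmetric] eq], of x]
      permutes_self_in_orbit[OF tf fin, of x]
    by (simp add: transpose_comp_transpose_comp)
  also have "orbit (?t \<circ> f) x = {x}" by (simp add: orbit_eq_singleton_iff)
  finally have orb: "orbit f x = {x} \<union> orbit (?t \<circ> f) (f x)" .
  have split: "orbit (?t \<circ> f) y = orbit (?t \<circ> f) (f x)" if "y \<in> orbit f x" "y \<noteq> x" for y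
    by (rule permutes_orbit_eq[OF tf fin]) (use that orb in blast)
  have in_A: "y \<in> {1..n}" if "y \<in> orbit f x" for y
    using that permutes_orbit_subset[OF f x] by auto
  \<comment> \<open>The arc is half open: it contains \<open>f x\<close> exactly when
    \<open>f x < x\<close>, so this one condition covers both orders of \<open>x\<close> and
    \<open>f x\<close>.\<close>
  have no: False
    if "y \<in> orbit f x" "y \<noteq> x" "y \<noteq> f x"
      "y \<in> {min x (f x)..<max x (f x)} \<longleftrightarrow> f x \<notin> {min x (f x)..<max x (f x)}" for y
  proof (cases "x < f x")
    case True
    then show False
      using that split[OF that(1,2)] eq
      by (intro geodesic_no_split_merge[OF f geo x fx _ _ in_A[OF that(1)] fx]) auto
  next
    case False
    then have "f x < x" using \<open>f x \<noteq> x\<close> by simp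
    then show False
      using that split[OF that(1,2)] eq
      by (intro geodesic_no_split_merge[OF f geo fx x _ _ in_A[OF that(1)] fx])
        (auto simp: transpose_commute)
  qed
  show ?thesis
  proof (cases "x < f x")
    case True
    have "f x \<le> y" if "y \<in> orbit f x" "x < y" for y
    proof (rule ccontr)
      assume "\<not> f x \<le> y"
      then show False using that True by (intro no[of y]) auto
    qed
    then show ?thesis using True orbit.base[of f x] by (auto simp: is_next_def)
  next
    case False
    have "y \<le> x \<and> f x \<le> y" if "y \<in> orbit f x" for y
    proof (rule ccontr)
      assume "\<not> (y \<le> x \<and> f x \<le> y)"
      then show False using that False \<open>f x \<noteq> x\<close> by (intro no[of y]) auto
    qed
    then show ?thesis using orbit.base[of f x] by (auto simp: is_next_def)
  qed
qed

lemma geodesic_eq_partition_perm: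
  assumes f: "f permutes {1..n}"
    and geo: "card (orbits f {1..n}) + card (orbits (inv f \<circ> full_cycle n) {1..n}) = Suc n"
  shows "partition_perm (orbits f {1..n}) = f"
proof
  fix x
  have part: "partition_on {1..n} (orbits f {1..n})" by (rule partition_on_orbits[OF f]) simp
  show "partition_perm (orbits f {1..n}) x = f x"
  proof (cases "x \<in> {1..n}")
    case True
    have "x \<in> orbit f x" by (rule permutes_self_in_orbit[OF f]) simp
    moreover have "orbit f x \<in> orbits f {1..n}" using True by (simp add: orbits_def)
    ultimately show ?thesis
      by (intro is_next_unique[OF partition_perm_next[OF part _ _] geodesic_is_next[OF f geo True]]) auto
  next
    case False
    then show ?thesis using permutes_not_in[OF f] permutes_not_in[OF partition_perm_permutes[OF part]] by simp
  qed
qed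

text \<open>Induction towards singletons: detaching the maximum \<open>r\<close> of a block
  \<open>V\<close> with minimum \<open>p\<close> keeps the partition noncrossing and adds one block.
  It multiplies \<open>P\<close> by \<open>transpose p r\<close>, so the complement must lose
  exactly one block, that is, \<open>p\<close> and \<open>r\<close> must lie in different cycles
  before the multiplication.\<close>

lemma card_kreweras:
  assumes "n \<ge> 1" "\<pi> \<in> noncrossing_partitions n"
  shows "card \<pi> + card (kreweras n \<pi>) = Suc n"
  using assms(2)
proof (induction "n - card \<pi>" arbitrary: \<pi> rule: less_induct)
  case less
  let ?A = "{1..n}" and ?\<gamma> = "full_cycle n"
  have fin: "finite ?A" by simp
  note \<gamma> = full_cycle_permutes[of n]
  have part: "partition_on ?A \<pi>"
    and nc: "\<And>V W i j k l. V \<in> \<pi> \<Longrightarrow> W \<in> \<pi> \<Longrightarrow> i \<in> V \<Longrightarrow> k \<in> V \<Longrightarrow> j \<in> W \<Longrightarrow> l \<in> W \<Longrightarrow>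
      i < j \<Longrightarrow> j < k \<Longrightarrow> k < l \<Longrightarrow> V = W"
    using less.prems unfolding noncrossing_partitions_iff by blast+
  have fin\<pi>: "finite \<pi>" by (rule finite_elements[OF fin part])
  define P where "P = partition_perm \<pi>"
  have P: "P permutes ?A" unfolding P_def by (rule partition_perm_permutes[OF part fin])
  have orbP: "orbits P ?A = \<pi>" unfolding P_def by (rule orbits_partition_perm[OF part fin])
  have nextP: "is_next V x (P x)" if "V \<in> \<pi>" "x \<in> V" for V x
    unfolding P_def by (rule partition_perm_next[OF part fin that])
  have disj: "V = W" if "V \<in> \<pi>" "W \<in> \<pi>" "x \<in> V" "x \<in> W" for V W x
    using partition_onD2[OF part] that by (auto dest: disjointD)
  have sub: "V \<subseteq> ?A" if "V \<in> \<pi>" for V using partition_onD1[OF part] that by auto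
  show ?case
  proof (cases "P = id")
    case True
    have "\<pi> = (\<lambda>x. {x}) ` ?A" using orbP True by (simp add: orbits_id)
    then have "card \<pi> = n" by (simp add: card_image)
    moreover have "kreweras n \<pi> = orbits ?\<gamma> ?A"
      using True by (simp add: kreweras_eq_orbits P_def[symmetric])
    moreover have "card (orbits ?\<gamma> ?A) = 1"
      using card_orbits_eq_1_iff[OF \<gamma>, of 1] orbit_full_cycle[of 1] assms(1) by simp
    ultimately show ?thesis by simp
  next
    case False
    then obtain x where x: "P x \<noteq> x" by (auto simp: fun_eq_iff)
    then have "x \<in> ?A" using permutes_not_in[OF P] by blast
    then obtain V where V: "V \<in> \<pi>" "x \<in> V" using partition_onD1[OF part] by blast
    have "P x \<in> V" using nextP[OF V] by (simp add: is_next_def)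
    have finV: "finite V" using sub[OF V(1)] fin by (rule finite_subset)
    define p where "p = Min V"
    define r where "r = Max V"
    have p: "p \<in> V" "\<And>y. y \<in> V \<Longrightarrow> p \<le> y" and r: "r \<in> V" "\<And>y. y \<in> V \<Longrightarrow> y \<le> r"
      using finV V(2) by (auto simp: p_def r_def intro!: Min_in Max_in)
    have pr: "p < r" using p(2)[OF V(2)] r(2)[OF V(2)] p(2)[OF \<open>P x \<in> V\<close>] r(2)[OF \<open>P x \<in> V\<close>] x by simp
    have prA: "p \<in> ?A" "r \<in> ?A" using sub[OF V(1)] p(1) r(1) by auto
    define \<pi>' where "\<pi>' = insert {r} (insert (V - {r}) (\<pi> - {V}))"
    have part': "partition_on ?A \<pi>'"
    proof (rule partition_onI)
      show "\<Union>\<pi>' = ?A"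
        using partition_onD1[OF part] V(1) r(1) by (auto simp: \<pi>'_def)
      show "{} \<notin> \<pi>'"
        using partition_onD3[OF part] p(1) pr by (auto simp: \<pi>'_def)
      show "disjnt S T" if "S \<in> \<pi>'" "T \<in> \<pi>'" "S \<noteq> T" for S T
        using that disj V(1) r(1) unfolding \<pi>'_def disjnt_iff by blast
    qed
    have Vr: "V - {r} \<notin> \<pi>" using disj[OF V(1) _ p(1), of "V - {r}"] p(1) pr r(1) by auto
    have r\<pi>: "{r} \<notin> \<pi>" using disj[OF V(1) _ r(1), of "{r}"] p(1) pr by auto
    have "card \<pi>' = Suc (Suc (card (\<pi> - {V})))"
      unfolding \<pi>'_def using fin\<pi> Vr r\<pi>
      by (subst card_insert_disjoint; (subst card_insert_disjoint)?) auto
    also have "Suc (card (\<pi> - {V})) = card \<pi>" using card_Suc_Diff1[OF fin\<pi> V(1)] .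
    finally have card': "card \<pi>' = Suc (card \<pi>)" .
    have nc': "\<pi>' \<in> noncrossing_partitions n"
      unfolding noncrossing_partitions_iff
    proof (intro conjI part' ballI impI)
      fix S T i j k l
      assume *: "S \<in> \<pi>'" "T \<in> \<pi>'" "i \<in> S" "k \<in> S" "j \<in> T" "l \<in> T" "i < j" "j < k" "k < l"
      then have ne: "i \<noteq> k" "j \<noteq> l" by auto
      obtain S' where S': "S' \<in> \<pi>" "S \<subseteq> S'" "S = S' \<or> S' = V \<and> S = V - {r}"
        using *(1,3,4) ne(1) V(1) unfolding \<pi>'_def by blast
      obtain T' where T': "T' \<in> \<pi>" "T \<subseteq> T'" "T = T' \<or> T' = V \<and> T = V - {r}"
        using *(2,5,6) ne(2) V(1) unfolding \<pi>'_def by blast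
      have "S' = T'" using nc[OF S'(1) T'(1) _ _ _ _ *(7-9)] *(3-6) S'(2) T'(2) by blast
      moreover have "V \<notin> \<pi>'" using p(1) r(1) pr unfolding \<pi>'_def by blast
      ultimately show "S = T" using S'(3) T'(3) *(1,2) by blast
    qed
    have "card \<pi>' \<le> n"
      using card_image_le[OF fin, of "orbit (partition_perm \<pi>')"] orbits_partition_perm[OF part' fin]
      by (simp add: orbits_def)
    then have IH: "card \<pi>' + card (kreweras n \<pi>') = Suc n"
      using less.hyps[OF _ nc'] card' by simp
    \<comment> \<open>Only two successors change: \<open>r\<close> becomes fixed, and the
      predecessor of \<open>r\<close> in \<open>V\<close> (third case) now wraps to
      \<open>p\<close>.\<close>
    have P': "partition_perm \<pi>' = transpose p r \<circ> P"
    proof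
      fix y
      show "partition_perm \<pi>' y = (transpose p r \<circ> P) y"
      proof (cases "y \<in> ?A")
        case False
        then show ?thesis
          using permutes_not_in[OF P] permutes_not_in[OF partition_perm_permutes[OF part' fin]] prA
          by (metis comp_apply transpose_apply_other)
      next
        case True
        then obtain W where W: "W \<in> \<pi>" "y \<in> W" using partition_onD1[OF part] by blast
        note nextW = nextP[OF W]
        consider "W \<noteq> V" | "y = r" | "W = V" "y \<noteq> r" "P y = r" | "W = V" "y \<noteq> r" "P y \<noteq> r" by blast
        then show ?thesis
        proof cases
          case 1
          then have "W \<in> \<pi>'" using W by (simp add: \<pi>'_def)
          from is_next_unique[OF partition_perm_next[OF part' fin this W(2)] nextW]
          have "partition_perm \<pi>' y = P y" .
          moreover have "P y \<in> W" using nextW by (simp add: is_next_def)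
          then have "P y \<noteq> p" "P y \<noteq> r" using 1 disj[OF V(1) W(1)] p(1) r(1) by auto
          ultimately show ?thesis by simp
        next
          case 2
          have "is_next {r} r (partition_perm \<pi>' r)"
            by (rule partition_perm_next[OF part' fin]) (auto simp: \<pi>'_def)
          then have "partition_perm \<pi>' r = r" by (simp add: is_next_def)
          moreover have "is_next V r p" using p r by (auto simp: is_next_def)
          then have "P r = p" using is_next_unique[OF nextP[OF V(1) r(1)]] by simp
          ultimately show ?thesis using 2 by simp
        next
          case 3
          have "is_next (V - {r}) y (partition_perm \<pi>' y)"
            using 3 W by (intro partition_perm_next[OF part' fin]) (auto simp: \<pi>'_def)
          moreover have "is_next (V - {r}) y p"
            using nextW 3 p r pr unfolding is_next_def by (metis Diff_iff insertI1 le_antisym not_le_imp_less singletonD W(2))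
          ultimately have "partition_perm \<pi>' y = p" by (rule is_next_unique)
          then show ?thesis using 3 by simp
        next
          case 4
          have "is_next (V - {r}) y (partition_perm \<pi>' y)"
            using 4 W by (intro partition_perm_next[OF part' fin]) (auto simp: \<pi>'_def)
          moreover have y: "y < P y"
            using nextW 4 r W unfolding is_next_def by (metis le_antisym)
          then have "is_next (V - {r}) y (P y)"
            using nextW 4 unfolding is_next_def by auto
          ultimately have "partition_perm \<pi>' y = P y" by (rule is_next_unique)
          moreover have "P y \<noteq> p" using y p(2) W 4 by force
          ultimately show ?thesis using 4 by simp
        qed
      qed
    qed
    \<comment> \<open>Conjugating the complement by \<open>P\<close> moves the transposition from
      the middle of the product to its left end, where \<open>card_orbits_merge\<close>
      applies.\<close>
    define \<delta> where "\<delta> = ?\<gamma> \<circ> inv P"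
    have \<delta>: "\<delta> permutes ?A" unfolding \<delta>_def by (rule permutes_compose[OF permutes_inv[OF P] \<gamma>])
    have t\<delta>: "transpose p r \<circ> \<delta> permutes ?A" using \<delta> prA by (intro permutes_compose permutes_swap_id)
    have "\<delta> = P \<circ> (inv P \<circ> ?\<gamma>) \<circ> inv P"
      by (simp add: \<delta>_def fun_eq_iff permutes_inverses[OF P])
    then have c\<delta>: "card (orbits \<delta> ?A) = card (kreweras n \<pi>)"
      using card_orbits_conj[OF permutes_compose[OF \<gamma> permutes_inv[OF P]] fin P]
      by (simp only: kreweras_eq_orbits P_def[symmetric])
    have "inv (transpose p r \<circ> P) = inv P \<circ> transpose p r"
      by (subst o_inv_distrib) (auto intro: permutes_bij[OF P])
    then have "kreweras n \<pi>' = orbits (inv P \<circ> (transpose p r \<circ> ?\<gamma>)) ?A"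
      by (simp only: kreweras_eq_orbits P' o_assoc)
    moreover have "transpose p r \<circ> \<delta> = P \<circ> (inv P \<circ> (transpose p r \<circ> ?\<gamma>)) \<circ> inv P"
      by (simp add: \<delta>_def fun_eq_iff permutes_inverses[OF P])
    moreover have "inv P \<circ> (transpose p r \<circ> ?\<gamma>) permutes ?A"
      using \<gamma> P prA by (intro permutes_compose permutes_swap_id permutes_inv)
    ultimately have ct\<delta>: "card (orbits (transpose p r \<circ> \<delta>) ?A) = card (kreweras n \<pi>')"
      using card_orbits_conj[OF _ fin P] by simp
    have "orbit \<delta> r \<subseteq> {p<..r}"
    proof (rule orbit_subset_invariant)
      show "\<delta> ` {p<..r} \<subseteq> {p<..r}"
      proof
        fix z assume "z \<in> \<delta> ` {p<..r}"
        then obtain y where y: "p < y" "y \<le> r" "z = \<delta> y" by auto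
        define w where "w = inv P y"
        have Pw: "P w = y" by (simp add: w_def permutes_inverses[OF P])
        have "y \<in> ?A" using y prA by auto
        then have "w \<in> ?A" unfolding w_def using permutes_in_image[OF permutes_inv[OF P]] by blast
        then obtain W where W: "W \<in> \<pi>" "w \<in> W" using partition_onD1[OF part] by blast
        note nextW = nextP[OF W, unfolded Pw]
        have yW: "y \<in> W" using nextW by (simp add: is_next_def)
        \<comment> \<open>The cyclic predecessor \<open>w\<close> of \<open>y\<close> stays between
          \<open>p\<close> and \<open>r\<close>. In \<open>V\<close> itself this holds because
          \<open>y\<close> is not the minimum; another block meeting the inside of \<open>V\<close>
          would cross \<open>V\<close> if it left the interval.\<close>
        have "p \<le> w \<and> w < r"
        proof (cases "W = V")
          case True
          then show ?thesis using nextW y p r W pr unfolding is_next_def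
            by (metis leD le_neq_implies_less le_less_trans)
        next
          case False
          then have ne: "p \<notin> W" "r \<notin> W" using disj[OF V(1) W(1)] p(1) r(1) by auto
          have "y < r" using y yW ne by (metis le_neq_implies_less)
          have "\<not> r < w" using nc[OF V(1) W(1) p(1) r(1) yW W(2) y(1) \<open>y < r\<close>] False by auto
          moreover have "\<not> w < p" using nc[OF W(1) V(1) W(2) yW p(1) r(1) _ y(1) \<open>y < r\<close>] False by auto
          moreover have "w \<noteq> r" using ne W by auto
          ultimately show ?thesis by auto
        qed
        moreover from this have "\<delta> y = Suc w"
          using full_cycle_apply[OF \<open>w \<in> ?A\<close>] prA(2) by (simp add: \<delta>_def w_def)
        ultimately show "z \<in> {p<..r}" using y by simp
      qed
    qed (use pr in simp)
    then have "orbit \<delta> p \<noteq> orbit \<delta> r"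
      using permutes_self_in_orbit[OF \<delta> fin, of p] by auto
    from card_orbits_merge[OF \<delta> fin prA this]
    show ?thesis using IH card' c\<delta> ct\<delta> by simp
  qed
qed

text \<open>Taking cycles and taking the permutation of a partition are mutually inverse between
  geodesics and noncrossing partitions; \<open>card_kreweras\<close> ensures that the second map
  lands in the geodesics.\<close>

theorem sum_geodesics_eq_sum_noncrossing:
  assumes "n \<ge> 1"
  shows "(\<Sum>f | f permutes {1..n} \<and>
      card (orbits f {1..n}) + card (orbits (inv f \<circ> full_cycle n) {1..n}) = Suc n.
      F (orbits f {1..n}) (orbits (inv f \<circ> full_cycle n) {1..n}))
    = (\<Sum>\<pi>\<in>noncrossing_partitions n. F \<pi> (kreweras n \<pi>))"
proof (rule sum.reindex_bij_witness[of _ partition_perm "\<lambda>f. orbits f {1..n}"])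
  have part: "partition_on {1..n} \<pi>" if "\<pi> \<in> noncrossing_partitions n" for \<pi>
    using that by (simp add: noncrossing_partitions_iff)
  fix \<pi> assume \<pi>: "\<pi> \<in> noncrossing_partitions n"
  show orb: "orbits (partition_perm \<pi>) {1..n} = \<pi>"
    by (rule orbits_partition_perm[OF part[OF \<pi>]]) simp
  show "partition_perm \<pi> \<in> {f. f permutes {1..n} \<and>
      card (orbits f {1..n}) + card (orbits (inv f \<circ> full_cycle n) {1..n}) = Suc n}"
    using card_kreweras[OF assms \<pi>] partition_perm_permutes[OF part[OF \<pi>]] orb
    by (simp only: kreweras_eq_orbits mem_Collect_eq finite_atLeastAtMost)
next
  fix f assume "f \<in> {f. f permutes {1..n} \<and>
      card (orbits f {1..n}) + card (orbits (inv f \<circ> full_cycle n) {1..n}) = Suc n}"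
  then have f: "f permutes {1..n}"
    "card (orbits f {1..n}) + card (orbits (inv f \<circ> full_cycle n) {1..n}) = Suc n" by auto
  show *: "partition_perm (orbits f {1..n}) = f" by (rule geodesic_eq_partition_perm[OF f])
  show "orbits f {1..n} \<in> noncrossing_partitions n" by (rule geodesic_orbits_noncrossing[OF f])
  show "F (orbits f {1..n}) (kreweras n (orbits f {1..n})) =
      F (orbits f {1..n}) (orbits (inv f \<circ> full_cycle n) {1..n})"
    by (simp only: kreweras_eq_orbits *)
qed

section \<open>Pairs of permutations and exponential generating functions\<close>

text \<open>The conjugator lists the cycle of \<open>d\<close> in the order in which it is run
  through from \<open>1\<close>.\<close>

lemma full_cycle_conj:
  assumes d: "d permutes {1..n}" and orb: "orbit d 1 = {1..n}"
  obtains s where "s permutes {1..n}" "d = s \<circ> full_cycle n \<circ> inv s"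
proof -
  let ?A = "{1..n}"
  have n: "1 \<in> ?A" using permutes_self_in_orbit[OF d finite_atLeastAtMost, of 1] orb by blast
  then obtain m where m0: "m > 0" "(d ^^ m) 1 = 1"
    unfolding orb[symmetric] orbit_altdef by auto
  \<comment> \<open>The first return time to \<open>1\<close>; the powers below it are distinct and
    exhaust the orbit, so it equals \<open>n\<close>.\<close>
  define N where "N = (LEAST m. m > 0 \<and> (d ^^ m) 1 = 1)"
  have N: "N > 0 \<and> (d ^^ N) 1 = 1"
    unfolding N_def by (rule LeastI[of _ m]) (use m0 in blast)
  have less: "(d ^^ m) 1 \<noteq> 1" if "m < N" "0 < m" for m
    using not_less_Least[of m "\<lambda>m. m > 0 \<and> (d ^^ m) 1 = 1"] that unfolding N_def by blast
  have inj: "inj_on (\<lambda>k. (d ^^ k) 1) {0..<N}"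
    by (rule inj_on_funpow_least) (use N less in auto)
  have img: "(\<lambda>k. (d ^^ k) 1) ` {0..<N} = ?A"
    unfolding orb[symmetric] using orbit_altdef_bounded[of N d 1] N by auto
  have Nn: "N = n" using card_image[OF inj] unfolding img by simp
  define s where "s = (\<lambda>i. if i \<in> ?A then (d ^^ (i - 1)) 1 else i)"
  have "s ` ?A = (\<lambda>k. (d ^^ k) 1) ` {0..<N}"
  proof -
    have "s ` ?A = (\<lambda>k. (d ^^ k) 1) ` (\<lambda>i. i - 1) ` ?A"
      unfolding image_image by (intro image_cong) (auto simp: s_def)
    also have "(\<lambda>i. i - 1) ` ?A = {0..<N}"
    proof
      show "{0..<N} \<subseteq> (\<lambda>i. i - 1) ` ?A"
        by (auto simp: Nn intro!: image_eqI[of _ _ "Suc _"])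
    qed (auto simp: Nn)
    finally show ?thesis .
  qed
  then have "s ` ?A = ?A" using img by simp
  then have "bij_betw s ?A ?A"
    by (metis bij_betw_def eq_card_imp_inj_on finite_atLeastAtMost)
  then have s: "s permutes ?A"
    by (rule bij_imp_permutes) (auto simp: s_def)
  have step: "s (full_cycle n i) = d (s i)" for i
  proof (cases "i \<in> ?A")
    case True
    show ?thesis
    proof (cases "i = n")
      case True
      have "d ((d ^^ (n - 1)) 1) = (d ^^ N) 1"
        using N unfolding Nn by (cases n) auto
      then show ?thesis
        using True full_cycle_apply[of i n] \<open>i \<in> ?A\<close> n N by (simp add: s_def)
    next
      case False
      then have "full_cycle n i = Suc i" "Suc i \<in> ?A"
        using full_cycle_apply[of i n] True by auto
      moreover have "(d ^^ i) 1 = d ((d ^^ (i - 1)) 1)" using True by (cases i) auto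
      ultimately show ?thesis using True by (simp add: s_def)
    qed
  next
    case False
    then have "full_cycle n i = i" "d i = i" "s i = i"
      by (rule permutes_not_in[OF full_cycle_permutes], rule permutes_not_in[OF d],
          simp only: s_def if_False)
    then show ?thesis by simp
  qed
  have "d = s \<circ> full_cycle n \<circ> inv s"
  proof
    fix y
    have "d (s (inv s y)) = s (full_cycle n (inv s y))" using step by simp
    then show "d y = (s \<circ> full_cycle n \<circ> inv s) y"
      by (simp add: permutes_inverses[OF s])
  qed
  with s show thesis by (rule that)
qed

section \<open>Cutting a pair of permutations along a joint orbit\<close>

lemma joint_orbit_cong:
  assumes "x \<in> C" "f ` C \<subseteq> C" "g ` C \<subseteq> C"
    and "\<And>y. y \<in> C \<Longrightarrow> f' y = f y" "\<And>y. y \<in> C \<Longrightarrow> g' y = g y"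
  shows "joint_orbit f' g' x = joint_orbit f g x"
proof
  have sub: "joint_orbit f g x \<subseteq> C" by (rule joint_orbit_least[OF assms(1-3)])
  show "joint_orbit f' g' x \<subseteq> joint_orbit f g x"
  proof (rule joint_orbit_least[OF joint_orbit.self])
    have "f' y = f y" "g' y = g y" if "y \<in> joint_orbit f g x" for y
      using assms(4,5) sub that by blast+
    then show "f' ` joint_orbit f g x \<subseteq> joint_orbit f g x" "g' ` joint_orbit f g x \<subseteq> joint_orbit f g x"
      by (auto intro: joint_orbit.intros)
  qed
  have sub': "joint_orbit f' g' x \<subseteq> C"
    by (rule joint_orbit_least[OF assms(1)]) (use assms in auto)
  show "joint_orbit f g x \<subseteq> joint_orbit f' g' x"
  proof (rule joint_orbit_least[OF joint_orbit.self])
    have "f y = f' y" "g y = g' y" if "y \<in> joint_orbit f' g' x" for y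
      using assms(4,5) sub' that by force+
    then show "f ` joint_orbit f' g' x \<subseteq> joint_orbit f' g' x" "g ` joint_orbit f' g' x \<subseteq> joint_orbit f' g' x"
      by (auto intro: joint_orbit.intros)
  qed
qed

definition perm_weight :: "(nat \<Rightarrow> 'a :: comm_monoid_mult) \<Rightarrow> nat set \<Rightarrow> (nat \<Rightarrow> nat) \<Rightarrow> 'a" where
  "perm_weight u A f = part_prod u (orbits f A)"

text \<open>As a function of \<open>card A\<close>, its exponential generating function is
  \<open>exp (\<Sum>j. u j * t ^ j / j)\<close>.\<close>

definition perm_sum :: "(nat \<Rightarrow> 'a :: comm_semiring_1) \<Rightarrow> nat set \<Rightarrow> 'a" where
  "perm_sum u A = (\<Sum>f | f permutes A. perm_weight u A f)"

definition transitive_pairs :: "nat \<Rightarrow> nat set \<Rightarrow> ((nat \<Rightarrow> nat) \<times> (nat \<Rightarrow> nat)) set" where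
  "transitive_pairs x A = {(f, g). f permutes A \<and> g permutes A \<and> joint_orbit f g x = A}"

definition transitive_sum ::
    "(nat \<Rightarrow> 'a :: comm_semiring_1) \<Rightarrow> (nat \<Rightarrow> 'a) \<Rightarrow> nat \<Rightarrow> nat set \<Rightarrow> 'a" where
  "transitive_sum u v x A = (\<Sum>(f, g)\<in>transitive_pairs x A. perm_weight u A f * perm_weight v A g)"

lemma finite_transitive_pairs:
  assumes "finite A"
  shows "finite (transitive_pairs x A)"
proof (rule finite_subset)
  show "transitive_pairs x A \<subseteq> {f. f permutes A} \<times> {f. f permutes A}"
    unfolding transitive_pairs_def by blast
  show "finite ({f. f permutes A} \<times> {f. f permutes A})"
    using finite_permutations[OF assms] by blast
qed

lemma permutes_restrict_invariant:
  assumes "f permutes A" "finite C" "f ` C \<subseteq> C"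
  shows "perm_restrict f C permutes C"
proof (rule bij_imp_permutes)
  have inj: "inj_on f C" by (rule inj_on_subset[OF permutes_inj[OF assms(1)]]) simp
  have "f ` C = C" by (rule endo_inj_surj[OF assms(2,3) inj])
  then have "bij_betw f C C" using inj by (simp add: bij_betw_def)
  then show "bij_betw (perm_restrict f C) C C"
    by (subst bij_betw_cong[of _ _ f]) (auto simp: perm_restrict_def)
  show "perm_restrict f C y = y" if "y \<notin> C" for y
    using that by (simp add: perm_restrict_def)
qed

lemma perm_restrict_comp_disjoint:
  assumes "f permutes C" "g permutes D" "C \<inter> D = {}"
  shows "perm_restrict (f \<circ> g) C = f" "perm_restrict (f \<circ> g) D = g"
proof -
  have *: "g x = x" if "x \<in> C" for x
    using permutes_not_in[OF assms(2)] that assms(3) by blast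
  have **: "f (g x) = g x" if "x \<in> D" for x
    using permutes_not_in[OF assms(1)] permutes_in_image[OF assms(2), of x] that assms(3) by blast
  show "perm_restrict (f \<circ> g) C = f"
    using * permutes_not_in[OF assms(1)] by (auto simp: fun_eq_iff perm_restrict_def)
  show "perm_restrict (f \<circ> g) D = g"
    using ** permutes_not_in[OF assms(2)] by (auto simp: fun_eq_iff perm_restrict_def)
qed

lemma perm_weight_comp_disjoint:
  assumes f: "f permutes C" and g: "g permutes D" and disj: "C \<inter> D = {}"
    and fin: "finite C" "finite D"
  shows "perm_weight u (C \<union> D) (f \<circ> g) = perm_weight u C f * perm_weight u D g"
proof -
  have 1: "orbit (f \<circ> g) x = orbit f x" if "x \<in> C" for x
  proof (rule orbit_cong[OF permutes_self_in_orbit[OF f fin(1)]])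
    fix s assume "s \<in> orbit f x"
    then have "s \<in> C" using permutes_orbit_subset[OF f that] by blast
    then have "s \<notin> D" using disj by blast
    then show "(f \<circ> g) s = f s" using permutes_not_in[OF g, of s] by simp
  qed
  have 2: "orbit (f \<circ> g) x = orbit g x" if "x \<in> D" for x
  proof (rule orbit_cong[OF permutes_self_in_orbit[OF g fin(2)]])
    fix s assume "s \<in> orbit g x"
    then have "s \<in> D" using permutes_orbit_subset[OF g that] by blast
    then have "g s \<in> D" using permutes_in_image[OF g] by blast
    then have "g s \<notin> C" using disj by blast
    then show "(f \<circ> g) s = g s" using permutes_not_in[OF f, of "g s"] by simp
  qed
  have orbs: "orbits (f \<circ> g) (C \<union> D) = orbits f C \<union> orbits g D"
    unfolding orbits_def image_Un using 1 2 by simp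
  have "orbits f C \<inter> orbits g D = {}"
  proof (rule ccontr)
    assume "orbits f C \<inter> orbits g D \<noteq> {}"
    then obtain V where V: "V \<in> orbits f C" "V \<in> orbits g D" by blast
    then have "V \<subseteq> C" "V \<subseteq> D" using Union_orbits[OF f fin(1)] Union_orbits[OF g fin(2)] by blast+
    then have "V = {}" using disj by blast
    then show False using V(1) orbit_nonempty[of f] by (auto simp: orbits_def)
  qed
  then show ?thesis
    unfolding perm_weight_def orbs part_prod_def
    by (intro prod.union_disjoint finite_orbits fin)
qed

text \<open>Sort the pairs by the joint orbit of \<open>x\<close>. On this orbit the pair is
  transitive, off it arbitrary, and the weights multiply. This is the counting form of
  \<open>H' = h' H\<close>, with \<open>x\<close> as the marked point.\<close>

lemma perm_sum_product_decomposition: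
  assumes fin: "finite A" and x: "x \<notin> A"
  shows "perm_sum u (insert x A) * perm_sum v (insert x A) =
    (\<Sum>B\<in>Pow A. transitive_sum u v x (insert x B) * (perm_sum u (A - B) * perm_sum v (A - B)))"
proof -
  let ?P = "\<lambda>A. {f :: nat \<Rightarrow> nat. f permutes A}"
  let ?X = "insert x A"
  define W where "W = (\<lambda>A (f, g). perm_weight u A f * perm_weight v A g)"
  \<comment> \<open>Dropping the marked point makes the index range over the subsets of
    \<open>A\<close>.\<close>
  define J where "J = (\<lambda>(f, g). joint_orbit f g x - {x})"
  have finP: "finite (?P ?X \<times> ?P ?X)" using fin by (simp add: finite_permutations)
  have "perm_sum u ?X * perm_sum v ?X = (\<Sum>p\<in>?P ?X \<times> ?P ?X. W ?X p)"
    by (simp add: perm_sum_def sum_product sum.cartesian_product W_def)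
  also have "\<dots> = (\<Sum>B\<in>Pow A. \<Sum>p | p \<in> ?P ?X \<times> ?P ?X \<and> J p = B. W ?X p)"
  proof (rule sum.group[symmetric, OF finP])
    show "J ` (?P ?X \<times> ?P ?X) \<subseteq> Pow A"
    proof safe
      fix f g y assume "f permutes ?X" "g permutes ?X" "y \<in> J (f, g)"
      then show "y \<in> A" using joint_orbit_subset[of f ?X g x] by (auto simp: J_def)
    qed
    show "finite (Pow A)" using fin by simp
  qed
  also have "\<dots> = (\<Sum>B\<in>Pow A. transitive_sum u v x (insert x B) *
      (perm_sum u (A - B) * perm_sum v (A - B)))"
  proof (rule sum.cong[OF refl])
    fix B assume "B \<in> Pow A"
    define C where "C = insert x B"
    define D where "D = A - B"
    have CD: "C \<inter> D = {}" "C \<union> D = ?X" "x \<in> C" and finCD: "finite C" "finite D"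
      using \<open>B \<in> Pow A\<close> x fin by (auto simp: C_def D_def intro: finite_subset)
    have J_iff: "J (f, g) = B \<longleftrightarrow> joint_orbit f g x = C" for f g
      using joint_orbit.self[of x f g] x \<open>B \<in> Pow A\<close> by (auto simp: J_def C_def)
    let ?S = "{p. p \<in> ?P ?X \<times> ?P ?X \<and> J p = B}"
    let ?T = "transitive_pairs x C \<times> (?P D \<times> ?P D)"
    define glue where "glue = (\<lambda>((f1 :: nat \<Rightarrow> nat, g1 :: nat \<Rightarrow> nat),
      (f2 :: nat \<Rightarrow> nat, g2 :: nat \<Rightarrow> nat)). (f1 \<circ> f2, g1 \<circ> g2))"
    define cut where "cut = (\<lambda>(f, g).
      ((perm_restrict f C, perm_restrict g C), (perm_restrict f D, perm_restrict g D)))"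
    have "(\<Sum>p\<in>?S. W ?X p) = (\<Sum>t\<in>?T. W C (fst t) * W D (snd t))"
    proof (rule sum.reindex_bij_witness[of _ glue cut])
      fix p assume p: "p \<in> ?S"
      obtain f g where fg: "p = (f, g)" by (cases p)
      have f: "f permutes ?X" and g: "g permutes ?X" and J: "joint_orbit f g x = C"
        using p J_iff by (auto simp: fg)
      have fC: "f ` C \<subseteq> C" and gC: "g ` C \<subseteq> C"
        using joint_orbit_invariant(1)[where f = f and g = g and x = x]
          joint_orbit_invariant(2)[where f = f and g = g and x = x] unfolding J by auto
      have split: "perm_restrict h C permutes C" "perm_restrict h D permutes D"
        "perm_restrict h C \<circ> perm_restrict h D = h" if h: "h permutes ?X" and hC: "h ` C \<subseteq> C" for h
      proof -
        \<comment> \<open>The complement is invariant as well, because an injective map sends no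
          outside point into a finite invariant set.\<close>
        have "h y \<in> D" if "y \<in> D" for y
          using invariant_in_iff[OF permutes_inj[OF h] finCD(1) hC, of y] permutes_in_image[OF h, of y]
            that CD by blast
        then have hD: "h ` D \<subseteq> D" by blast
        show C: "perm_restrict h C permutes C" by (rule permutes_restrict_invariant[OF h finCD(1) hC])
        show D: "perm_restrict h D permutes D" by (rule permutes_restrict_invariant[OF h finCD(2) hD])
        show "perm_restrict h C \<circ> perm_restrict h D = h"
          using perm_restrict_union[OF C D CD(1)] h CD(2) by simp
      qed
      note sf = split[OF f fC] and sg = split[OF g gC]
      have J': "joint_orbit (perm_restrict f C) (perm_restrict g C) x = C"
        using joint_orbit_cong[OF CD(3) fC gC, of "perm_restrict f C" "perm_restrict g C"] J
        by (simp add: perm_restrict_def)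
      show "glue (cut p) = p"
        using sf sg by (simp add: fg glue_def cut_def)
      show "cut p \<in> ?T"
        using sf sg J' by (simp add: fg transitive_pairs_def cut_def)
      have "W ?X p = W (C \<union> D) (perm_restrict f C \<circ> perm_restrict f D,
          perm_restrict g C \<circ> perm_restrict g D)"
        using sf sg CD(2) by (simp add: fg)
      also have "\<dots> = W C (perm_restrict f C, perm_restrict g C) *
          W D (perm_restrict f D, perm_restrict g D)"
        unfolding W_def prod.case
        by (simp only: perm_weight_comp_disjoint[OF sf(1,2) CD(1) finCD]
            perm_weight_comp_disjoint[OF sg(1,2) CD(1) finCD] mult_ac)
      finally show "W C (fst (cut p)) * W D (snd (cut p)) = W ?X p"
        by (simp add: fg cut_def)
    next
      fix t assume t: "t \<in> ?T"
      obtain f1 g1 f2 g2 where t_eq: "t = ((f1, g1), (f2, g2))" by (metis surj_pair)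
      have f1: "f1 permutes C" and g1: "g1 permutes C" and f2: "f2 permutes D" and g2: "g2 permutes D"
        and J: "joint_orbit f1 g1 x = C"
        using t by (auto simp: t_eq transitive_pairs_def)
      note rf = perm_restrict_comp_disjoint[OF f1 f2 CD(1)]
        and rg = perm_restrict_comp_disjoint[OF g1 g2 CD(1)]
      show "cut (glue t) = t"
        by (simp only: t_eq glue_def cut_def prod.case rf rg)
      have sub: "C \<subseteq> ?X" "D \<subseteq> ?X" using CD by auto
      have "f1 \<circ> f2 permutes ?X"
        using permutes_subset[OF f1 sub(1)] permutes_subset[OF f2 sub(2)] by (rule permutes_compose[rotated])
      moreover have "g1 \<circ> g2 permutes ?X"
        using permutes_subset[OF g1 sub(1)] permutes_subset[OF g2 sub(2)] by (rule permutes_compose[rotated])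
      moreover have "joint_orbit (f1 \<circ> f2) (g1 \<circ> g2) x = joint_orbit f1 g1 x"
      proof (rule joint_orbit_cong[OF CD(3)])
        have "f2 y = y" "g2 y = y" if "y \<in> C" for y
          using permutes_not_in[OF f2, of y] permutes_not_in[OF g2, of y] that CD(1) by blast+
        then show "(f1 \<circ> f2) y = f1 y" "(g1 \<circ> g2) y = g1 y" if "y \<in> C" for y
          using that by simp_all
      qed (simp_all add: permutes_image[OF f1] permutes_image[OF g1])
      ultimately show "glue t \<in> ?S"
        using J by (simp add: t_eq glue_def J_iff)
    qed
    also have "\<dots> = (\<Sum>p\<in>transitive_pairs x C. W C p) * (\<Sum>q\<in>?P D \<times> ?P D. W D q)"
      by (simp add: sum_product sum.cartesian_product case_prod_beta)
    also have "(\<Sum>q\<in>?P D \<times> ?P D. W D q) = perm_sum u D * perm_sum v D"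
      by (simp add: perm_sum_def sum_product sum.cartesian_product W_def)
    also have "(\<Sum>p\<in>transitive_pairs x C. W C p) = transitive_sum u v x C"
      by (simp add: transitive_sum_def W_def)
    finally show "(\<Sum>p\<in>?S. W ?X p) = transitive_sum u v x (insert x B) *
        (perm_sum u (A - B) * perm_sum v (A - B))"
      by (simp only: C_def D_def)
  qed
  finally show ?thesis .
qed

lemma sum_Pow_card:
  fixes \<phi> :: "nat \<Rightarrow> 'a :: comm_semiring_1"
  assumes "finite A"
  shows "(\<Sum>B\<in>Pow A. \<phi> (card B)) = (\<Sum>j\<le>card A. of_nat (card A choose j) * \<phi> j)"
proof -
  have "(\<Sum>B\<in>Pow A. \<phi> (card B)) = (\<Sum>j\<le>card A. \<Sum>B | B \<in> Pow A \<and> card B = j. \<phi> (card B))"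
    by (rule sum.group[symmetric]) (use assms in \<open>auto intro: card_mono\<close>)
  also have "\<dots> = (\<Sum>j\<le>card A. of_nat (card A choose j) * \<phi> j)"
    using n_subsets[OF assms] by (intro sum.cong) auto
  finally show ?thesis .
qed

text \<open>Exponential generating functions \<open>H = exp h\<close>, in the form \<open>H' = h' H\<close>.\<close>

definition exp_recurrence :: "nat \<Rightarrow> (nat \<Rightarrow> 'a :: comm_ring_1) \<Rightarrow> (nat \<Rightarrow> 'a) \<Rightarrow> bool" where
  "exp_recurrence N H h \<longleftrightarrow> H 0 = 1 \<and>
     (\<forall>n<N. H (Suc n) = (\<Sum>j\<le>n. of_nat (n choose j) * (h (Suc j) * H (n - j))))"

lemma perm_sum_empty: "perm_sum u {} = 1"
proof -
  have "{f :: nat \<Rightarrow> nat. f permutes {}} = {id}" by auto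
  then have "perm_sum u {} = perm_weight u {} id" by (simp add: perm_sum_def)
  also have "\<dots> = 1" by (simp add: perm_weight_def orbits_def part_prod_def)
  finally show ?thesis .
qed

text \<open>Both sides satisfy the same recurrence in terms of \<open>H\<close>. The summand for the
  full subset has the factor \<open>H 0 = 1\<close>, so it can be solved for once the smaller
  subsets agree by induction.\<close>

lemma transitive_sum_eq:
  fixes u v :: "nat \<Rightarrow> 'a :: comm_ring_1"
  assumes rec: "exp_recurrence N H h"
    and H: "\<And>A. finite A \<Longrightarrow> card A \<le> N \<Longrightarrow> perm_sum u A * perm_sum v A = H (card A)"
    and A: "finite A" "x \<notin> A" "card A < N"
  shows "transitive_sum u v x (insert x A) = h (Suc (card A))"
  using A
proof (induction "card A" arbitrary: A rule: less_induct)
  case less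
  have H0: "H 0 = 1" using rec by (simp add: exp_recurrence_def)
  have HD: "perm_sum u (A - B) * perm_sum v (A - B) = H (card A - card B)" if "B \<in> Pow A" for B
  proof -
    have "card (A - B) = card A - card B"
      using that less.prems(1) by (intro card_Diff_subset) (auto intro: finite_subset)
    then show ?thesis using H[of "A - B"] less.prems by simp
  qed
  have IH: "transitive_sum u v x (insert x B) = h (Suc (card B))" if "B \<in> Pow A - {A}" for B
  proof -
    have "card B < card A" using that less.prems(1) by (intro psubset_card_mono) auto
    then show ?thesis using that less.prems by (intro less.hyps) (auto intro: finite_subset)
  qed
  have "(\<Sum>B\<in>Pow A. transitive_sum u v x (insert x B) * H (card A - card B)) =
      perm_sum u (insert x A) * perm_sum v (insert x A)"
    unfolding perm_sum_product_decomposition[OF less.prems(1,2)] using HD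
    by (intro sum.cong) simp_all
  also have "\<dots> = H (Suc (card A))"
    using H[of "insert x A"] less.prems by simp
  also have "\<dots> = (\<Sum>B\<in>Pow A. h (Suc (card B)) * H (card A - card B))"
    using rec less.prems(3) sum_Pow_card[OF less.prems(1), of "\<lambda>j. h (Suc j) * H (card A - j)"]
    by (simp add: exp_recurrence_def)
  finally have "(\<Sum>B\<in>Pow A - {A}. transitive_sum u v x (insert x B) * H (card A - card B)) +
      transitive_sum u v x (insert x A) =
      (\<Sum>B\<in>Pow A - {A}. h (Suc (card B)) * H (card A - card B)) + h (Suc (card A))"
    using less.prems(1) by (simp add: sum.remove[of "Pow A" A] H0 add.commute)
  then show ?case using IH by simp
qed

text \<open>With \<open>unit_weight\<close> as second weight only pairs \<open>(f, id)\<close> contribute, so statements about pairs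
  specialise to single permutations.\<close>

definition unit_weight :: "nat \<Rightarrow> 'a :: comm_semiring_1" where
  "unit_weight k = (if k = 1 then 1 else 0)"

lemma perm_weight_unit_weight:
  assumes "f permutes A" "finite A"
  shows "perm_weight unit_weight A f = (if f = id then 1 else 0)"
proof (cases "f = id")
  case True
  then show ?thesis
    by (simp add: perm_weight_def part_prod_def orbits_id unit_weight_def prod.reindex)
next
  case False
  then obtain x where x: "f x \<noteq> x" by (auto simp: fun_eq_iff)
  then have "x \<in> A" using permutes_not_in[OF assms(1)] by blast
  have "card (orbit f x) \<noteq> 1"
  proof
    assume "card (orbit f x) = 1"
    then obtain y where "orbit f x = {y}" by (rule card_1_singletonE)
    then show False using permutes_self_in_orbit[OF assms, of x] orbit.base[of f x] x by auto
  qed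
  then have "unit_weight (card (orbit f x)) = (0 :: 'a)" by (simp add: unit_weight_def)
  then have "perm_weight unit_weight A f = (0 :: 'a)"
    unfolding perm_weight_def part_prod_def
    using \<open>x \<in> A\<close> finite_orbits[OF assms(2)] by (intro prod_zero) (auto simp: orbits_def)
  then show ?thesis using False by simp
qed

lemma perm_sum_unit_weight:
  assumes "finite A"
  shows "perm_sum unit_weight A = 1"
proof -
  have "perm_sum unit_weight A = (\<Sum>f | f permutes A. if f = id then 1 else (0 :: 'a))"
    unfolding perm_sum_def by (rule sum.cong) (auto simp: perm_weight_unit_weight[OF _ assms])
  also have "\<dots> = 1" using assms by (subst sum.delta) (simp_all add: finite_permutations)
  finally show ?thesis .
qed

lemma transitive_sum_unit_weight:
  fixes u :: "nat \<Rightarrow> 'a :: comm_semiring_1"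
  assumes "finite A"
  shows "transitive_sum u unit_weight x A =
    of_nat (card {f. f permutes A \<and> orbit f x = A}) * u (card A)"
proof -
  have "transitive_sum u unit_weight x A =
      (\<Sum>p\<in>(\<lambda>f. (f, id)) ` {f. f permutes A \<and> orbit f x = A}.
        case p of (f, g) \<Rightarrow> perm_weight u A f * perm_weight unit_weight A g)"
    unfolding transitive_sum_def
  proof (rule sum.mono_neutral_right[OF finite_transitive_pairs[OF assms]])
    show "(\<lambda>f. (f, id)) ` {f. f permutes A \<and> orbit f x = A} \<subseteq> transitive_pairs x A"
      using joint_orbit_id_right[OF _ assms] by (auto simp: transitive_pairs_def)
    show "\<forall>p\<in>transitive_pairs x A - (\<lambda>f. (f, id)) ` {f. f permutes A \<and> orbit f x = A}.
        (case p of (f, g) \<Rightarrow> perm_weight u A f * perm_weight unit_weight A g) = 0"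
    proof safe
      fix f g assume *: "(f, g) \<in> transitive_pairs x A"
        "(f, g) \<notin> (\<lambda>f. (f, id)) ` {f. f permutes A \<and> orbit f x = A}"
      then have "g \<noteq> id" using joint_orbit_id_right[OF _ assms] by (auto simp: transitive_pairs_def)
      then have "perm_weight unit_weight A g = (0 :: 'a)"
        using * perm_weight_unit_weight[OF _ assms, of g] by (simp add: transitive_pairs_def)
      then show "perm_weight u A f * perm_weight unit_weight A g = 0" by simp
    qed
  qed
  also have "\<dots> = (\<Sum>f | f permutes A \<and> orbit f x = A. u (card A))"
  proof (subst sum.reindex)
    show "inj_on (\<lambda>f. (f, id)) {f. f permutes A \<and> orbit f x = A}" by (auto simp: inj_on_def)
    show "(\<Sum>f | f permutes A \<and> orbit f x = A.
        ((\<lambda>p. case p of (f, g) \<Rightarrow> perm_weight u A f * perm_weight unit_weight A g) \<circ> (\<lambda>f. (f, id))) f) =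
        (\<Sum>f | f permutes A \<and> orbit f x = A. u (card A))"
    proof (rule sum.cong[OF refl])
      fix f assume "f \<in> {f. f permutes A \<and> orbit f x = A}"
      then have f: "f permutes A" "orbit f x = A" by auto
      then have "x \<in> A" using permutes_self_in_orbit[OF f(1) assms, of x] by simp
      then have "orbits f A = {A}"
        using f permutes_orbit_eq[OF f(1) assms] by (auto simp: orbits_def)
      then show "((\<lambda>p. case p of (f, g) \<Rightarrow> perm_weight u A f * perm_weight unit_weight A g) \<circ>
          (\<lambda>f. (f, id))) f = u (card A)"
        using perm_weight_unit_weight[OF permutes_id assms, where 'a = 'a]
        by (simp add: perm_weight_def[of u] part_prod_def)
    qed
  qed
  finally show ?thesis by simp
qed

text \<open>The generating function form is \<open>1 / (1 - t) = exp (- ln (1 - t))\<close>.\<close>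

lemma exp_recurrence_fact:
  "exp_recurrence N fact (\<lambda>k. fact (k - 1) :: 'a :: {comm_ring_1, semiring_char_0})"
  unfolding exp_recurrence_def
proof (intro conjI allI impI)
  fix n :: nat
  have "(\<Sum>j\<le>n. of_nat (n choose j) * (fact (Suc j - 1) * fact (n - j))) = (\<Sum>j\<le>n. fact n :: 'a)"
  proof (rule sum.cong[OF refl])
    fix j assume "j \<in> {..n}"
    then have "fact j * fact (n - j) * (n choose j) = (fact n :: nat)"
      by (intro binomial_fact_lemma) simp
    then have "of_nat (fact j * fact (n - j) * (n choose j)) = (of_nat (fact n) :: 'a)" by (rule arg_cong)
    then show "of_nat (n choose j) * (fact (Suc j - 1) * fact (n - j)) = (fact n :: 'a)"
      by (simp add: mult_ac)
  qed
  then show "(fact (Suc n) :: 'a) = (\<Sum>j\<le>n. of_nat (n choose j) * (fact (Suc j - 1) * fact (n - j)))"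
    by simp
  show "fact 0 = (1 :: 'a)" by simp
qed

text \<open>With all weights equal to 1 the sum over permutations is a factorial, whose logarithmic
  coefficients are already known; the connected objects are the cycles through all points.\<close>

theorem card_cyclic_permutations:
  fixes x :: nat
  assumes "finite A" "x \<in> A"
  shows "card {f. f permutes A \<and> orbit f x = A} = fact (card A - 1)"
proof -
  define B where "B = A - {x}"
  have B: "finite B" "x \<notin> B" "A = insert x B" using assms by (auto simp: B_def)
  have one: "perm_sum (\<lambda>_. 1 :: int) C = fact (card C)" if "finite C" for C
    using card_permutations[OF refl that]
    by (simp add: perm_sum_def perm_weight_def part_prod_def)
  have "transitive_sum (\<lambda>_. 1 :: int) unit_weight x (insert x B) = fact (Suc (card B) - 1)"
    by (rule transitive_sum_eq[OF exp_recurrence_fact _ B(1,2) lessI])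
      (simp add: one perm_sum_unit_weight)
  then have "int (card {f. f permutes A \<and> orbit f x = A}) = int (fact (card B))"
    using transitive_sum_unit_weight[OF assms(1), of "\<lambda>_. 1 :: int" x] B(3) by simp
  then have "card {f. f permutes A \<and> orbit f x = A} = fact (card B)"
    by (simp only: of_nat_eq_iff)
  then show ?thesis using B by simp
qed

text \<open>The factor \<open>fact (k - 1)\<close> is the number of cyclic arrangements of the
  \<open>k\<close> points in the cycle of the marked point.\<close>

lemma perm_sum_eq:
  fixes u :: "nat \<Rightarrow> 'a :: {comm_ring_1, semiring_char_0}"
  assumes rec: "exp_recurrence N H (\<lambda>k. fact (k - 1) * u k)"
    and A: "finite A" "card A \<le> N"
  shows "perm_sum u A = H (card A)"
  using A
proof (induction "card A" arbitrary: A rule: less_induct)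
  case less
  have H0: "H 0 = 1" using rec by (simp add: exp_recurrence_def)
  show ?case
  proof (cases "A = {}")
    case True
    then show ?thesis by (simp add: perm_sum_empty H0)
  next
    case False
    then obtain x where "x \<in> A" by blast
    define B where "B = A - {x}"
    have B: "finite B" "x \<notin> B" "A = insert x B" using less.prems(1) \<open>x \<in> A\<close> by (auto simp: B_def)
    have "perm_sum u A = perm_sum u A * perm_sum unit_weight A"
      by (simp add: perm_sum_unit_weight less.prems(1))
    also have "\<dots> = (\<Sum>C\<in>Pow B. transitive_sum u unit_weight x (insert x C) *
        (perm_sum u (B - C) * perm_sum unit_weight (B - C)))"
      unfolding B(3) by (rule perm_sum_product_decomposition[OF B(1,2)])
    also have "\<dots> = (\<Sum>C\<in>Pow B. fact (card C) * u (Suc (card C)) * H (card B - card C))"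
    proof (rule sum.cong[OF refl])
      fix C assume C: "C \<in> Pow B"
      then have finC: "finite C" and xC: "x \<notin> C" using B finite_subset by auto
      have "transitive_sum u unit_weight x (insert x C) = fact (card C) * u (Suc (card C))"
        using card_cyclic_permutations[of "insert x C" x] finC xC
        by (subst transitive_sum_unit_weight) (simp_all add: of_nat_fact)
      moreover have card: "card (B - C) = card B - card C" using C finC by (intro card_Diff_subset) auto
      then have "perm_sum u (B - C) = H (card B - card C)"
        using less.hyps[of "B - C"] less.prems(2) B by simp
      ultimately show "transitive_sum u unit_weight x (insert x C) *
          (perm_sum u (B - C) * perm_sum unit_weight (B - C)) =
          fact (card C) * u (Suc (card C)) * H (card B - card C)"
        using B(1) by (simp add: perm_sum_unit_weight)
    qed
    also have "\<dots> = (\<Sum>j\<le>card B. of_nat (card B choose j) * (fact j * u (Suc j) * H (card B - j)))"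
      by (rule sum_Pow_card[OF B(1)])
    also have "\<dots> = H (card A)"
      using rec less.prems(2) B by (simp add: exp_recurrence_def)
    finally show ?thesis .
  qed
qed

text \<open>Here the termwise product gets its logarithm: \<open>F k * G k\<close> sums over all
  pairs on \<open>k\<close> points, so \<open>h\<close> sums over the transitive ones.\<close>

theorem transitive_sum_product:
  fixes u v :: "nat \<Rightarrow> 'a :: {comm_ring_1, semiring_char_0}"
  assumes "exp_recurrence n F (\<lambda>k. fact (k - 1) * u k)"
    and "exp_recurrence n G (\<lambda>k. fact (k - 1) * v k)"
    and "exp_recurrence n H h"
    and FG: "\<And>k. k \<le> n \<Longrightarrow> H k = F k * G k"
    and n: "n \<ge> 1"
  shows "transitive_sum u v 1 {1..n} = h n"
proof -
  have "transitive_sum u v 1 (insert 1 {2..n}) = h (Suc (card {2..n}))"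
  proof (rule transitive_sum_eq[OF assms(3)])
    show "perm_sum u A * perm_sum v A = H (card A)" if "finite A" "card A \<le> n" for A
      using perm_sum_eq[OF assms(1) that] perm_sum_eq[OF assms(2) that] FG[OF that(2)] by simp
    show "finite {2..n}" "1 \<notin> {2..n}" "card {2..n} < n" using n by auto
  qed
  moreover have "insert 1 {2..n} = {1..n}" "Suc (card {2..n}) = n" using n by auto
  ultimately show ?thesis by simp
qed

section \<open>Planar factorizations of cycles through all points\<close>

lemma perm_weight_conj:
  assumes f: "f permutes A" and fin: "finite A" and s: "s permutes A"
  shows "perm_weight u A (s \<circ> f \<circ> inv s) = perm_weight u A f"
proof -
  have inj: "inj_on ((`) s) (orbits f A)"
    using inj_on_image_Pow[OF permutes_inj[OF s]] by (rule inj_on_subset) simp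
  have "card (s ` V) = card V" for V
    by (intro card_image inj_on_subset[OF permutes_inj[OF s]]) simp
  then show ?thesis
    unfolding perm_weight_def part_prod_def orbits_conj[OF f fin s]
    by (simp add: prod.reindex[OF inj])
qed

text \<open>Simultaneous conjugation of both factors carries factorizations of one cycle to those of
  another and preserves cycle types, hence weights.\<close>

lemma sum_factorizations_conj:
  assumes d: "d permutes {1..n}" "orbit d 1 = {1..n}"
  shows "(\<Sum>f | f permutes {1..n} \<and>
        card (orbits f {1..n}) + card (orbits (inv f \<circ> d) {1..n}) = Suc n.
        perm_weight a {1..n} f * perm_weight b {1..n} (inv f \<circ> d))
    = (\<Sum>f | f permutes {1..n} \<and>
        card (orbits f {1..n}) + card (orbits (inv f \<circ> full_cycle n) {1..n}) = Suc n.
        perm_weight a {1..n} f * perm_weight b {1..n} (inv f \<circ> full_cycle n))"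
proof -
  let ?A = "{1..n}"
  have fin: "finite ?A" by simp
  obtain s where s: "s permutes ?A" and d_eq: "d = s \<circ> full_cycle n \<circ> inv s"
    using full_cycle_conj[OF d] .
  have si: "inv s permutes ?A" by (rule permutes_inv[OF s])
  have ss: "inv (inv s) = s" by (rule permutes_inv_inv[OF s])
  note invs = permutes_inverses[OF s]
  have conj: "s \<circ> h \<circ> inv s permutes ?A" "inv s \<circ> h \<circ> s permutes ?A" if "h permutes ?A" for h
    using that s si by (auto intro: permutes_compose)
  have inv_conj: "inv (s \<circ> h \<circ> inv s) \<circ> d = s \<circ> (inv h \<circ> full_cycle n) \<circ> inv s"
    if h: "h permutes ?A" for h
  proof -
    have "inv (s \<circ> h \<circ> inv s) = s \<circ> inv h \<circ> inv s"
      using permutes_bij[OF s] permutes_bij[OF h] permutes_bij[OF si] ss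
      by (simp add: o_inv_distrib bij_comp o_assoc)
    then show ?thesis by (simp add: d_eq fun_eq_iff invs)
  qed
  have fc: "inv h \<circ> full_cycle n permutes ?A" if "h permutes ?A" for h
    by (rule permutes_compose[OF full_cycle_permutes permutes_inv[OF that]])
  have undo: "s \<circ> (inv s \<circ> h \<circ> s) \<circ> inv s = h" "inv s \<circ> (s \<circ> h \<circ> inv s) \<circ> s = h" for h
    by (simp_all add: fun_eq_iff invs)
  show ?thesis
  proof (rule sum.reindex_bij_witness[of _ "\<lambda>f. s \<circ> f \<circ> inv s" "\<lambda>f. inv s \<circ> f \<circ> s"])
    fix f assume f: "f \<in> {f. f permutes ?A \<and> card (orbits f ?A) + card (orbits (inv f \<circ> d) ?A) = Suc n}"
    define h where "h = inv s \<circ> f \<circ> s"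
    have fh: "f = s \<circ> h \<circ> inv s" by (simp add: h_def undo)
    have h: "h permutes ?A" unfolding h_def using f by (intro conj) simp
    show "s \<circ> (inv s \<circ> f \<circ> s) \<circ> inv s = f" by (rule undo)
    show "inv s \<circ> f \<circ> s \<in> {f. f permutes ?A \<and>
        card (orbits f ?A) + card (orbits (inv f \<circ> full_cycle n) ?A) = Suc n}"
      unfolding h_def[symmetric] using f h
      by (simp add: fh inv_conj[OF h] card_orbits_conj[OF _ fin s] fc)
    show "perm_weight a ?A (inv s \<circ> f \<circ> s) *
        perm_weight b ?A (inv (inv s \<circ> f \<circ> s) \<circ> full_cycle n) =
        perm_weight a ?A f * perm_weight b ?A (inv f \<circ> d)"
      unfolding h_def[symmetric] by (simp add: fh inv_conj[OF h] perm_weight_conj[OF _ fin s] fc h)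
  next
    fix h assume "h \<in> {f. f permutes ?A \<and>
        card (orbits f ?A) + card (orbits (inv f \<circ> full_cycle n) ?A) = Suc n}"
    then have h: "h permutes ?A"
      and c: "card (orbits h ?A) + card (orbits (inv h \<circ> full_cycle n) ?A) = Suc n" by auto
    show "inv s \<circ> (s \<circ> h \<circ> inv s) \<circ> s = h" by (rule undo)
    show "s \<circ> h \<circ> inv s \<in> {f. f permutes ?A \<and>
        card (orbits f ?A) + card (orbits (inv f \<circ> d) ?A) = Suc n}"
      using c by (simp add: inv_conj[OF h] card_orbits_conj[OF _ fin s] fc h conj)
  qed
qed

lemma card_orbits_pos:
  assumes "finite A" "A \<noteq> {}"
  shows "card (orbits f A) \<ge> 1"
  using assms finite_orbits[OF assms(1)] by (simp add: orbits_def card_gt_0_iff Suc_le_eq One_nat_def)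

text \<open>The product \<open>f \<circ> g\<close> has at least one cycle, which uses up one unit of
  the bound in the genus inequality.\<close>

lemma transitive_pairs_card_orbits:
  assumes fg: "(f, g) \<in> transitive_pairs x A" and A: "finite A" "x \<in> A"
  shows "card (orbits f A) + card (orbits g A) \<le> Suc (card A)"
    and "card (orbits f A) + card (orbits g A) = Suc (card A) \<Longrightarrow> orbit (f \<circ> g) x = A"
proof -
  have f: "f permutes A" and g: "g permutes A" and J: "joint_orbit f g x = A"
    using fg by (auto simp: transitive_pairs_def)
  have genus: "card (orbits f A) + card (orbits g A) + card (orbits (f \<circ> g) A) \<le> card A + 2"
    by (rule genus_inequality_transitive[OF f g A J])
  have "card (orbits (f \<circ> g) A) \<ge> 1" using A by (intro card_orbits_pos) auto
  with genus show "card (orbits f A) + card (orbits g A) \<le> Suc (card A)" by simp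
  assume "card (orbits f A) + card (orbits g A) = Suc (card A)"
  with genus \<open>card (orbits (f \<circ> g) A) \<ge> 1\<close> have "card (orbits (f \<circ> g) A) = 1" by simp
  then show "orbit (f \<circ> g) x = A"
    using card_orbits_eq_1_iff[OF permutes_compose[OF g f] A] by simp
qed

theorem sum_planar_transitive_pairs:
  fixes a b :: "nat \<Rightarrow> 'a :: {comm_ring_1, semiring_char_0}"
  assumes n: "n \<ge> 1"
  shows "(\<Sum>(f, g) | (f, g) \<in> transitive_pairs 1 {1..n} \<and>
        card (orbits f {1..n}) + card (orbits g {1..n}) = Suc n.
        perm_weight a {1..n} f * perm_weight b {1..n} g)
    = fact (n - 1) * (\<Sum>\<pi>\<in>noncrossing_partitions n. part_prod a \<pi> * part_prod b (kreweras n \<pi>))"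
proof -
  let ?A = "{1..n}"
  let ?S = "{(f, g). (f, g) \<in> transitive_pairs 1 ?A \<and> card (orbits f ?A) + card (orbits g ?A) = Suc n}"
  let ?D = "{d. d permutes ?A \<and> orbit d 1 = ?A}"
  let ?F = "\<lambda>d. {f. f permutes ?A \<and> card (orbits f ?A) + card (orbits (inv f \<circ> d) ?A) = Suc n}"
  define K where "K = (\<Sum>\<pi>\<in>noncrossing_partitions n. part_prod a \<pi> * part_prod b (kreweras n \<pi>))"
  have fin: "finite ?A" and A1: "1 \<in> ?A" using n by auto
  have "(\<Sum>(f, g)\<in>?S. perm_weight a ?A f * perm_weight b ?A g) =
      (\<Sum>(d, f)\<in>(SIGMA d:?D. ?F d). perm_weight a ?A f * perm_weight b ?A (inv f \<circ> d))"
  proof (rule sum.reindex_bij_witness[of _ "\<lambda>(d, f). (f, inv f \<circ> d)" "\<lambda>(f, g). (f \<circ> g, f)"])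
    fix p assume p: "p \<in> ?S"
    obtain f g where fg: "p = (f, g)" by (cases p)
    have tp: "(f, g) \<in> transitive_pairs 1 ?A"
      and c: "card (orbits f ?A) + card (orbits g ?A) = Suc n" using p by (auto simp: fg)
    have f: "f permutes ?A" and g: "g permutes ?A" using tp by (auto simp: transitive_pairs_def)
    have eq: "inv f \<circ> (f \<circ> g) = g" by (simp add: fun_eq_iff permutes_inverses[OF f])
    have "orbit (f \<circ> g) 1 = ?A"
      using transitive_pairs_card_orbits(2)[OF tp fin A1] c by simp
    then show "(case p of (f, g) \<Rightarrow> (f \<circ> g, f)) \<in> (SIGMA d:?D. ?F d)"
      using permutes_compose[OF g f] f c by (simp add: fg eq)
    show "(case case p of (f, g) \<Rightarrow> (f \<circ> g, f) of (d, f) \<Rightarrow> (f, inv f \<circ> d)) = p"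
      by (simp only: fg prod.case eq)
    show "(case case p of (f, g) \<Rightarrow> (f \<circ> g, f) of (d, f) \<Rightarrow>
        perm_weight a ?A f * perm_weight b ?A (inv f \<circ> d)) =
        (case p of (f, g) \<Rightarrow> perm_weight a ?A f * perm_weight b ?A g)"
      by (simp only: fg prod.case eq)
  next
    fix p assume p: "p \<in> (SIGMA d:?D. ?F d)"
    obtain d f where df: "p = (d, f)" by (cases p)
    have d: "d permutes ?A" "orbit d 1 = ?A" and f: "f permutes ?A"
      and c: "card (orbits f ?A) + card (orbits (inv f \<circ> d) ?A) = Suc n" using p by (auto simp: df)
    have eq: "f \<circ> (inv f \<circ> d) = d" by (simp add: fun_eq_iff permutes_inverses[OF f])
    show "(case case p of (d, f) \<Rightarrow> (f, inv f \<circ> d) of (f, g) \<Rightarrow> (f \<circ> g, f)) = p"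
      by (simp only: df prod.case eq)
    have fd: "inv f \<circ> d permutes ?A" by (rule permutes_compose[OF d(1) permutes_inv[OF f]])
    \<comment> \<open>Transitivity is automatic, since the product \<open>d\<close> alone already
      reaches every point from \<open>1\<close>.\<close>
    have "joint_orbit f (inv f \<circ> d) 1 = ?A"
      using orbit_comp_subset_joint_orbit[of f "inv f \<circ> d" 1] joint_orbit_subset[OF f fd A1]
      unfolding eq d(2) by blast
    then show "(case p of (d, f) \<Rightarrow> (f, inv f \<circ> d)) \<in> ?S"
      using f fd c by (simp add: df transitive_pairs_def)
  qed
  also have "\<dots> = (\<Sum>d\<in>?D. \<Sum>f\<in>?F d. perm_weight a ?A f * perm_weight b ?A (inv f \<circ> d))"
    by (rule sum.Sigma[symmetric]) (auto intro: finite_subset[OF _ finite_permutations[OF fin]])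
  also have "\<dots> = (\<Sum>d\<in>?D. K)"
  proof (rule sum.cong[OF refl])
    fix d assume "d \<in> ?D"
    then have d: "d permutes ?A" "orbit d 1 = ?A" by auto
    show "(\<Sum>f\<in>?F d. perm_weight a ?A f * perm_weight b ?A (inv f \<circ> d)) = K"
      unfolding sum_factorizations_conj[OF d]
      using sum_geodesics_eq_sum_noncrossing[OF n, of "\<lambda>\<sigma> \<tau>. part_prod a \<sigma> * part_prod b \<tau>"]
      by (simp only: perm_weight_def K_def)
  qed
  also have "\<dots> = fact (n - 1) * K"
    using card_cyclic_permutations[OF fin A1] by (simp add: of_nat_fact)
  finally show ?thesis by (simp only: K_def)
qed

declare One_nat_def [simp]

section \<open>Cumulants, moments and coefficients\<close>

unbundle fps_syntax

section \<open>Set partitions and composition of power series\<close>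

lemma sum_partitions_insert:
  assumes fin: "finite A" and x: "x \<notin> A"
  shows "(\<Sum>\<pi> | partition_on (insert x A) \<pi>. G \<pi>) =
    (\<Sum>B\<in>Pow A. \<Sum>\<pi> | partition_on (A - B) \<pi>. G (insert (insert x B) \<pi>))"
proof -
  let ?T = "SIGMA B:Pow A. {\<pi>. partition_on (A - B) \<pi>}"
  define blk where "blk = (\<lambda>\<pi>. THE V. V \<in> \<pi> \<and> x \<in> V)"
  have blk: "blk \<pi> = V" if "partition_on (insert x A) \<pi>" "V \<in> \<pi>" "x \<in> V" for \<pi> V
    unfolding blk_def using that partition_onD2[OF that(1)]
    by (intro the_equality) (auto dest: disjointD)
  have "(\<Sum>\<pi> | partition_on (insert x A) \<pi>. G \<pi>) =
      (\<Sum>(B, \<pi>)\<in>?T. G (insert (insert x B) \<pi>))"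
  proof (rule sum.reindex_bij_witness[of _ "\<lambda>(B, \<pi>). insert (insert x B) \<pi>"
        "\<lambda>\<pi>. (blk \<pi> - {x}, \<pi> - {blk \<pi>})"])
    fix \<pi> assume "\<pi> \<in> {\<pi>. partition_on (insert x A) \<pi>}"
    then have part: "partition_on (insert x A) \<pi>" by simp
    then obtain V where V: "V \<in> \<pi>" "x \<in> V" using partition_onD1[OF part] by blast
    have b: "blk \<pi> = V" by (rule blk[OF part V])
    have ins: "insert x (V - {x}) = V" "insert V (\<pi> - {V}) = \<pi>" using V by auto
    show "(case (blk \<pi> - {x}, \<pi> - {blk \<pi>}) of (B, \<pi>) \<Rightarrow> insert (insert x B) \<pi>) = \<pi>"
      by (simp only: prod.case b ins)
    show "(case (blk \<pi> - {x}, \<pi> - {blk \<pi>}) of (B, \<pi>) \<Rightarrow> G (insert (insert x B) \<pi>)) = G \<pi>"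
      by (simp only: prod.case b ins)
    have "disjnt V (\<Union>(\<pi> - {V}))"
      using partition_onD2[OF part] V(1) by (auto simp: disjnt_iff dest: disjointD)
    then have "partition_on (insert x A - V) (\<pi> - {V})" "V \<subseteq> insert x A"
      using partition_on_insert[of V "\<pi> - {V}" "insert x A"] part ins(2) by auto
    moreover have "insert x A - V = A - (V - {x})" using V x by auto
    ultimately show "(blk \<pi> - {x}, \<pi> - {blk \<pi>}) \<in> ?T" by (auto simp: b)
  next
    fix t assume t: "t \<in> ?T"
    obtain B \<pi> where t_eq: "t = (B, \<pi>)" by (cases t)
    have B: "B \<subseteq> A" and part: "partition_on (A - B) \<pi>" using t by (auto simp: t_eq)
    have xB: "x \<notin> B" using B x by auto
    have "disjnt (insert x B) (\<Union>\<pi>)" using partition_onD1[OF part] x by (auto simp: disjnt_iff)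
    moreover have "insert x A - insert x B = A - B" using x by auto
    ultimately have part': "partition_on (insert x A) (insert (insert x B) \<pi>)"
      using partition_on_insert[of "insert x B" \<pi> "insert x A"] part B by auto
    have b: "blk (insert (insert x B) \<pi>) = insert x B" by (rule blk[OF part']) auto
    have "insert x B \<notin> \<pi>" using partition_onD1[OF part] x by blast
    then show "(blk (case t of (B, \<pi>) \<Rightarrow> insert (insert x B) \<pi>) - {x},
        (case t of (B, \<pi>) \<Rightarrow> insert (insert x B) \<pi>) -
        {blk (case t of (B, \<pi>) \<Rightarrow> insert (insert x B) \<pi>)}) = t"
      using xB by (simp add: t_eq b)
    show "(case t of (B, \<pi>) \<Rightarrow> insert (insert x B) \<pi>) \<in> {\<pi>. partition_on (insert x A) \<pi>}"
      using part' by (simp add: t_eq)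
  qed
  also have "\<dots> = (\<Sum>B\<in>Pow A. \<Sum>\<pi> | partition_on (A - B) \<pi>. G (insert (insert x B) \<pi>))"
    using fin by (intro sum.Sigma[symmetric]) (auto intro: finitely_many_partition_on)
  finally show ?thesis .
qed

text \<open>The Faa di Bruno formula, proved through the chain rule: the block of a marked point
  contributes the derivative of \<open>F\<close>, the remaining blocks a composition with the
  derivative of the outer series. Differentiation shifts \<open>w\<close>, which is why the
  induction runs over all \<open>w\<close>.\<close>

lemma sum_partitions_fps_compose:
  fixes u w :: "nat \<Rightarrow> 'a :: field_char_0" and A :: "nat set"
  defines "F \<equiv> Abs_fps (\<lambda>n. if n = 0 then 0 else u n / fact n)"
  assumes "finite A"
  shows "(\<Sum>\<pi> | partition_on A \<pi>. w (card \<pi>) * part_prod u \<pi>) =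
    fact (card A) * (Abs_fps (\<lambda>i. w i / fact i) oo F) $ card A"
  using assms(2)
proof (induction "card A" arbitrary: A w rule: less_induct)
  case less
  show ?case
  proof (cases "A = {}")
    case True
    have "{\<pi> :: nat set set. partition_on {} \<pi>} = {{}}" by (auto simp: partition_on_empty)
    then show ?thesis by (simp add: True part_prod_def)
  next
    case False
    then obtain x where "x \<in> A" by blast
    define B where "B = A - {x}"
    have B: "finite B" "x \<notin> B" "A = insert x B" using less.prems(1) \<open>x \<in> A\<close> by (auto simp: B_def)
    define n where "n = card B"
    have cA: "card A = Suc n" using B by (simp add: n_def)
    define W where "W = Abs_fps (\<lambda>i. w i / fact i)"
    have W': "fps_deriv W = Abs_fps (\<lambda>i. w (Suc i) / fact i)"
      by (simp add: W_def fps_eq_iff field_simps del: of_nat_Suc)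
    have F0: "F $ 0 = 0" by (simp add: F_def)
    have F': "fps_deriv F $ j = u (Suc j) / fact j" for j
      by (simp add: F_def field_simps del: of_nat_Suc)
    have "(\<Sum>\<pi> | partition_on A \<pi>. w (card \<pi>) * part_prod u \<pi>) =
        (\<Sum>C\<in>Pow B. \<Sum>\<pi> | partition_on (B - C) \<pi>.
          w (card (insert (insert x C) \<pi>)) * part_prod u (insert (insert x C) \<pi>))"
      unfolding B(3) by (rule sum_partitions_insert[OF B(1,2)])
    also have "\<dots> = (\<Sum>C\<in>Pow B. u (Suc (card C)) *
        (fact (n - card C) * (fps_deriv W oo F) $ (n - card C)))"
    proof (rule sum.cong[OF refl])
      fix C assume C: "C \<in> Pow B"
      then have finC: "finite C" and xC: "x \<notin> C" using B finite_subset by auto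
      have card: "card (B - C) = n - card C" using C finC unfolding n_def by (intro card_Diff_subset) auto
      have "(\<Sum>\<pi> | partition_on (B - C) \<pi>.
          w (card (insert (insert x C) \<pi>)) * part_prod u (insert (insert x C) \<pi>)) =
          (\<Sum>\<pi> | partition_on (B - C) \<pi>. u (Suc (card C)) * (w (Suc (card \<pi>)) * part_prod u \<pi>))"
      proof (rule sum.cong[OF refl])
        fix \<pi> assume "\<pi> \<in> {\<pi>. partition_on (B - C) \<pi>}"
        then have part: "partition_on (B - C) \<pi>" by simp
        have "finite \<pi>" using finite_elements[OF _ part] B(1) by simp
        moreover have "insert x C \<notin> \<pi>" using partition_onD1[OF part] B(2) by blast
        ultimately show "w (card (insert (insert x C) \<pi>)) * part_prod u (insert (insert x C) \<pi>) =
            u (Suc (card C)) * (w (Suc (card \<pi>)) * part_prod u \<pi>)"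
          using finC xC by (simp add: part_prod_def mult_ac)
      qed
      also have "\<dots> = u (Suc (card C)) * (fact (n - card C) * (fps_deriv W oo F) $ (n - card C))"
        using less.hyps[of "B - C" "\<lambda>i. w (Suc i)"] card cA B(1)
        by (simp add: W' sum_distrib_left[symmetric])
      finally show "(\<Sum>\<pi> | partition_on (B - C) \<pi>.
          w (card (insert (insert x C) \<pi>)) * part_prod u (insert (insert x C) \<pi>)) =
          u (Suc (card C)) * (fact (n - card C) * (fps_deriv W oo F) $ (n - card C))" .
    qed
    also have "\<dots> = (\<Sum>j\<le>n. of_nat (n choose j) *
        (u (Suc j) * (fact (n - j) * (fps_deriv W oo F) $ (n - j))))"
      unfolding n_def by (rule sum_Pow_card[OF B(1)])
    also have "\<dots> = (\<Sum>j\<le>n. fact n * (fps_deriv F $ j * (fps_deriv W oo F) $ (n - j)))"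
      by (intro sum.cong refl) (simp add: F' binomial_fact field_simps del: fps_deriv_nth)
    also have "\<dots> = fact n * fps_deriv (W oo F) $ n"
      by (simp add: fps_compose_deriv[OF F0] fps_mult_nth sum_distrib_left atLeast0AtMost
          mult.commute[of "fps_deriv W oo F"] del: fps_deriv_nth)
    also have "\<dots> = fact (card A) * (W oo F) $ card A"
      by (simp add: cA mult_ac)
    finally show ?thesis by (simp only: W_def)
  qed
qed

text \<open>The partition sum composes \<open>F\<close> with the series with coefficients
  \<open>(-1) ^ i / i\<close>, which is \<open>- ln (1 + t)\<close> up to a constant. So
  \<open>h\<close> collects the coefficients of \<open>ln (1 + F)\<close>, and the recurrence is its
  differentiated form.\<close>

theorem exp_recurrence_log:
  fixes H :: "nat \<Rightarrow> 'a :: field_char_0"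
  assumes H0: "H 0 = 1"
  shows "exp_recurrence N H
    (\<lambda>n. - (\<Sum>\<pi>\<in>set_partitions n. (-1) ^ card \<pi> * fact (card \<pi> - 1) * part_prod H \<pi>))"
  unfolding exp_recurrence_def
proof (intro conjI allI impI H0)
  fix n
  define F where "F = Abs_fps (\<lambda>n. if n = 0 then 0 else H n / fact n)"
  define S where "S n = (\<Sum>\<pi>\<in>set_partitions n. (-1) ^ card \<pi> * fact (card \<pi> - 1) * part_prod H \<pi>)" for n
  define L where "L = (1 - fps_ln 1) oo F"
  have F0: "F $ 0 = 0" by (simp add: F_def)
  \<comment> \<open>The summand 1 is the coefficient at \<open>i = 0\<close>, where truncated
    subtraction gives \<open>fact (0 - 1) = 1\<close>; it disappears on differentiating.\<close>
  have "Abs_fps (\<lambda>i. (-1) ^ i * fact (i - 1) / fact i) = (1 - fps_ln 1 :: 'a fps)"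
  proof (rule fps_ext)
    fix i
    show "Abs_fps (\<lambda>i. (-1) ^ i * fact (i - 1) / fact i) $ i = (1 - fps_ln 1 :: 'a fps) $ i"
      by (cases i) (simp_all add: fps_ln_nth del: of_nat_Suc)
  qed
  then have S: "S k = fact k * L $ k" for k
    using sum_partitions_fps_compose[of "{1..k}" "\<lambda>i. (-1) ^ i * fact (i - 1)" H]
    by (simp add: S_def L_def F_def set_partitions_def)
  have one: "(1 + fps_X) $ 0 \<noteq> (0 :: 'a)" by simp
  have "fps_deriv L = - (inverse (1 + fps_X) oo F) * fps_deriv F"
    by (simp add: L_def fps_compose_deriv[OF F0] fps_ln_deriv fps_compose_uminus)
  also have "inverse (1 + fps_X) oo F = inverse (1 + F)"
    using fps_inverse_compose[OF F0 one] F0 by (simp add: fps_compose_add_distrib)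
  finally have "fps_deriv L * (1 + F) = - fps_deriv F * (inverse (1 + F) * (1 + F))"
    by (simp add: mult_ac)
  also have "inverse (1 + F) * (1 + F) = 1"
    by (rule inverse_mult_eq_1) (simp add: F0)
  finally have LF: "fps_deriv L * (1 + F) = - fps_deriv F" by simp
  have L': "fps_deriv L $ j = S (Suc j) / fact j" for j
    by (simp add: S field_simps del: of_nat_Suc)
  have F1: "(1 + F) $ j = H j / fact j" for j
    by (simp add: F_def H0)
  have "fps_deriv F $ n = H (Suc n) / fact n"
    by (simp add: F_def field_simps del: of_nat_Suc)
  then have "H (Suc n) = - fact n * (fps_deriv L * (1 + F)) $ n"
    unfolding LF by simp
  also have "\<dots> = (\<Sum>j\<le>n. of_nat (n choose j) * (- S (Suc j) * H (n - j)))"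
    unfolding fps_mult_nth L' F1 atLeast0AtMost sum_distrib_left
    by (intro sum.cong refl) (simp add: binomial_fact field_simps)
  finally show "H (Suc n) = (\<Sum>j\<le>n. of_nat (n choose j) * (- (\<Sum>\<pi>\<in>set_partitions (Suc j).
      (-1) ^ card \<pi> * fact (card \<pi> - 1) * part_prod H \<pi>) * H (n - j)))"
    by (simp only: S_def)
qed

lemma exp_recurrence_cong:
  assumes "exp_recurrence N H h" "\<And>k. k \<le> N \<Longrightarrow> H k = H' k"
    "\<And>k. 1 \<le> k \<Longrightarrow> k \<le> N \<Longrightarrow> h k = h' k"
  shows "exp_recurrence N H' h'"
  unfolding exp_recurrence_def
proof (intro conjI allI impI)
  show "H' 0 = 1" using assms(1) assms(2)[of 0] by (simp add: exp_recurrence_def)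
  fix n assume n: "n < N"
  have "H (Suc n) = (\<Sum>j\<le>n. of_nat (n choose j) * (h (Suc j) * H (n - j)))"
    using assms(1) n by (simp add: exp_recurrence_def)
  moreover have "\<dots> = (\<Sum>j\<le>n. of_nat (n choose j) * (h' (Suc j) * H' (n - j)))"
    by (intro sum.cong refl) (use assms(2,3) n in auto)
  ultimately show "H' (Suc n) = (\<Sum>j\<le>n. of_nat (n choose j) * (h' (Suc j) * H' (n - j)))"
    using assms(2)[of "Suc n"] n by simp
qed

section \<open>Power sums of roots and Newton's identities\<close>

lemma fps_of_poly_reflect_linear_factors:
  fixes M :: "'a :: idom multiset"
  shows "fps_of_poly (reflect_poly (\<Prod>z\<in>#M. [:- z, 1:])) = (\<Prod>z\<in>#M. 1 - fps_const z * fps_X)"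
proof (induction M)
  case (add z M)
  have lin: "fps_of_poly (reflect_poly [:- z, 1:]) = 1 - fps_const z * fps_X"
    by (simp add: reflect_poly_def fps_of_poly_pCons mult.commute)
  show ?case
    by (simp only: image_mset_add_mset prod_mset.add_mset reflect_poly_mult fps_of_poly_mult lin add)
qed simp

text \<open>The logarithmic derivative of one factor is minus the geometric series with coefficients
  \<open>z ^ Suc n\<close>; products of factors add these up.\<close>

lemma newton_identity_fps:
  fixes M :: "'a :: field_char_0 multiset"
  defines "R \<equiv> (\<Prod>z\<in>#M. 1 - fps_const z * fps_X)"
  shows "fps_deriv R = - Abs_fps (\<lambda>n. \<Sum>z\<in>#M. z ^ Suc n) * R"
  unfolding R_def
proof (induction M)
  case (add z M)
  define R where "R = (\<Prod>z\<in>#M. 1 - fps_const z * fps_X)"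
  define G where "G = Abs_fps (\<lambda>n. \<Sum>z\<in>#M. z ^ Suc n)"
  define g where "g = Abs_fps (\<lambda>n. z ^ Suc n)"
  have "g * (1 - fps_const z * fps_X) = g - fps_X * (fps_const z * g)"
    by (simp add: algebra_simps)
  also have "\<dots> = fps_const z"
  proof (rule fps_ext)
    fix n show "(g - fps_X * (fps_const z * g)) $ n = fps_const z $ n"
      by (cases n) (simp_all add: g_def)
  qed
  finally have geo: "g * (1 - fps_const z * fps_X) = fps_const z" .
  have IH: "fps_deriv R = - G * R" using add by (simp add: R_def G_def)
  have "Abs_fps (\<lambda>n. \<Sum>z\<in>#add_mset z M. z ^ Suc n) = g + G"
    by (simp add: G_def g_def fps_eq_iff)
  then have "- Abs_fps (\<lambda>n. \<Sum>z\<in>#add_mset z M. z ^ Suc n) * ((1 - fps_const z * fps_X) * R) =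
      - (g * (1 - fps_const z * fps_X)) * R + (1 - fps_const z * fps_X) * (- G * R)"
    by (simp add: algebra_simps)
  also have "\<dots> = - fps_const z * R + (1 - fps_const z * fps_X) * fps_deriv R"
    by (simp only: geo IH)
  also have "\<dots> = fps_deriv ((1 - fps_const z * fps_X) * R)"
    by (simp add: algebra_simps flip: fps_const_neg)
  finally show ?case by (simp add: R_def)
qed (simp add: fps_eq_iff)

text \<open>Newton's identities concern the reversed polynomial, with coefficients
  \<open>(-1) ^ k * a\<^sub>k\<close>; undoing this sign produces the division by
  \<open>(- 1) ^ k\<close>, the analogue of \<open>(- d) ^ k\<close> for cumulants.\<close>

lemma exp_recurrence_moment:
  assumes deg: "degree q = d" and lead: "lead_coeff q = 1" and d: "d > 0"
  shows "exp_recurrence d (\<lambda>k. fact k * sgn_coeff q k)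
    (\<lambda>k. fact (k - 1) * (- of_nat d * moment q k / (- 1) ^ k))"
  unfolding exp_recurrence_def
proof (intro conjI allI impI)
  show "fact 0 * sgn_coeff q 0 = 1" using lead by (simp add: sgn_coeff_def)
  fix n assume n: "n < d"
  have "q \<noteq> 0" using lead by auto
  define R where "R = (\<Prod>z\<in>#proots q. 1 - fps_const z * fps_X)"
  have "q = (\<Prod>x\<in>#proots q. [:- x, 1:])"
    using complex_poly_decompose_multiset[of q] lead by simp
  then have "R = fps_of_poly (reflect_poly q)"
    unfolding R_def by (metis fps_of_poly_reflect_linear_factors)
  then have R: "R $ k = coeff (reflect_poly q) k" for k by simp
  \<comment> \<open>Beyond \<open>d\<close> the truncated subtraction in \<open>sgn_coeff\<close>
    would return the constant coefficient of \<open>q\<close> again.\<close>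
  have e: "sgn_coeff q k = (- 1) ^ k * R $ k" if "k \<le> d" for k
    using that deg by (simp add: sgn_coeff_def R coeff_reflect_poly)
  have m: "(\<Sum>z\<in>#proots q. z ^ k) = of_nat d * moment q k" for k
    using d deg by (simp add: moment_def)
  have "of_nat (Suc n) * R $ Suc n = fps_deriv R $ n" by simp
  also have "\<dots> = - (\<Sum>j\<le>n. of_nat d * moment q (Suc j) * R $ (n - j))"
    unfolding R_def newton_identity_fps
    by (simp add: fps_mult_nth atLeast0AtMost m sum_negf del: power_Suc)
  finally have newton: "of_nat (Suc n) * R $ Suc n = - (\<Sum>j\<le>n. of_nat d * moment q (Suc j) * R $ (n - j))" .
  have "fact (Suc n) * sgn_coeff q (Suc n) = (- 1) ^ Suc n * fact n * (of_nat (Suc n) * R $ Suc n)"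
    using n by (simp add: e)
  also have "\<dots> = (\<Sum>j\<le>n. (- 1) ^ n * fact n * (of_nat d * moment q (Suc j) * R $ (n - j)))"
    unfolding newton by (simp add: sum_distrib_left sum_negf)
  also have "\<dots> = (\<Sum>j\<le>n. of_nat (n choose j) *
      (fact (Suc j - 1) * (- of_nat d * moment q (Suc j) / (- 1) ^ Suc j) *
        (fact (n - j) * sgn_coeff q (n - j))))"
  proof (rule sum.cong[OF refl])
    fix j assume "j \<in> {..n}"
    then have j: "j \<le> n" by simp
    have "(- 1) ^ n = (- 1 :: complex) ^ j * (- 1) ^ (n - j)"
      using j by (simp flip: power_add)
    moreover have "- of_nat d * moment q (Suc j) / (- 1) ^ Suc j = (- 1) ^ j * (of_nat d * moment q (Suc j))"
      by (cases "even j") simp_all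
    moreover have "of_nat (n choose j) * fact j * fact (n - j) = (fact n :: complex)"
      using j by (simp add: binomial_fact field_simps)
    ultimately show "(- 1) ^ n * fact n * (of_nat d * moment q (Suc j) * R $ (n - j)) =
        of_nat (n choose j) * (fact (Suc j - 1) * (- of_nat d * moment q (Suc j) / (- 1) ^ Suc j) *
        (fact (n - j) * sgn_coeff q (n - j)))"
      using j n by (simp add: e mult_ac)
  qed
  finally show "fact (Suc n) * sgn_coeff q (Suc n) = (\<Sum>j\<le>n. of_nat (n choose j) *
      (fact (Suc j - 1) * (- of_nat d * moment q (Suc j) / (- 1) ^ Suc j) *
        (fact (n - j) * sgn_coeff q (n - j))))" .
qed

text \<open>The sum defining the cumulant is the partition sum of \<open>exp_recurrence_log\<close>
  for the rescaled coefficients \<open>H\<close>; the prefactor of the definition only has to be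
  inverted.\<close>

lemma exp_recurrence_cumulant:
  assumes deg: "degree p = d" and lead: "lead_coeff p = 1" and d: "d > 0"
  shows "exp_recurrence d (\<lambda>k. fact k * sgn_coeff p k / of_nat (falling d k))
    (\<lambda>k. fact (k - 1) * (- of_nat d * ff_cumulant d p k / (- of_nat d) ^ k))"
proof -
  define H where "H k = fact k * sgn_coeff p k / of_nat (falling d k)" for k
  have H0: "H 0 = 1" using lead by (simp add: H_def sgn_coeff_def falling_def)
  define S where "S n = (\<Sum>\<pi>\<in>set_partitions n. (-1) ^ card \<pi> * fact (card \<pi> - 1) * part_prod H \<pi>)" for n
  have "part_prod H \<pi> = part_prod fact \<pi> * part_prod (sgn_coeff p) \<pi> / of_nat (part_prod (falling d) \<pi>)" for \<pi>
    by (simp add: part_prod_def H_def prod_dividef prod.distrib)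
  then have S: "ff_cumulant d p n = (- of_nat d) ^ n / (of_nat d * fact (n - 1)) * S n" for n
    unfolding ff_cumulant_def S_def by (intro arg_cong2[of _ _ _ _ "(*)"] refl sum.cong) simp
  have "- S k = fact (k - 1) * (- of_nat d * ff_cumulant d p k / (- of_nat d) ^ k)" for k
    using d by (simp add: S)
  then show ?thesis
    using exp_recurrence_log[where H = H, OF H0, of d] exp_recurrence_cong[of d H _ H]
    by (simp only: S_def[symmetric] H_def[symmetric])
qed

text \<open>This identity turns the binomial in the convolution into \<open>fact k\<close> over
  \<open>falling d k\<close>, which makes the rescaled coefficients multiplicative.\<close>

lemma falling_eq: "k \<le> d \<Longrightarrow> falling d k = fact k * (d choose k)"
proof (induction k)
  case (Suc k)
  then have "falling d (Suc k) = fact k * ((d choose k) * (d - k))"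
    by (simp add: falling_def mult_ac)
  also have "(d choose k) * (d - k) = (d choose Suc k) * Suc k"
    using binomial_absorb_comp[of d k] binomial_absorption[of k d] by (simp add: mult.commute)
  finally show ?case by (simp add: algebra_simps)
qed (simp add: falling_def)

lemma ff_mult_conv_props:
  assumes "degree p = d" "lead_coeff p = 1" "degree q = d" "lead_coeff q = 1"
  shows "degree (ff_mult_conv d p q) = d" "lead_coeff (ff_mult_conv d p q) = 1"
    and "\<And>k. k \<le> d \<Longrightarrow> sgn_coeff (ff_mult_conv d p q) k = sgn_coeff p k * sgn_coeff q k / of_nat (d choose k)"
proof -
  let ?r = "ff_mult_conv d p q"
  have coeff: "coeff ?r (d - k) = (-1) ^ k * (sgn_coeff p k * sgn_coeff q k / of_nat (d choose k))"
    if "k \<le> d" for k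
  proof -
    have "coeff ?r (d - k) = (\<Sum>j\<le>d. if j = k then
        (-1) ^ j * (sgn_coeff p j * sgn_coeff q j / of_nat (d choose j)) else 0)"
      unfolding ff_mult_conv_def coeff_sum using that by (intro sum.cong) auto
    then show ?thesis using that by simp
  qed
  have "coeff ?r d = 1" using coeff[of 0] assms by (simp add: sgn_coeff_def)
  moreover have "degree ?r \<le> d"
    unfolding ff_mult_conv_def
    by (intro degree_sum_le) (auto intro: order.trans[OF degree_monom_le])
  ultimately show deg: "degree ?r = d" by (metis le_antisym le_degree zero_neq_one)
  then show "lead_coeff ?r = 1" using \<open>coeff ?r d = 1\<close> by simp
  show "sgn_coeff ?r k = sgn_coeff p k * sgn_coeff q k / of_nat (d choose k)" if "k \<le> d" for k
    using coeff[OF that] by (simp add: sgn_coeff_def[of ?r] deg)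
qed

section \<open>Collecting the powers of d\<close>

lemma perm_weight_scaled:
  fixes a :: "nat \<Rightarrow> 'a :: field"
  assumes f: "f permutes A" "finite A"
  shows "perm_weight (\<lambda>k. x * a k / y ^ k) A f = x ^ card (orbits f A) / y ^ card A * perm_weight a A f"
proof -
  \<comment> \<open>The cycle lengths add up to \<open>card A\<close>, so the powers of
    \<open>y\<close> no longer depend on \<open>f\<close>, while \<open>x\<close> counts
    cycles.\<close>
  have "(\<Sum>V\<in>orbits f A. card V) = card A"
    using product_partition[OF partition_on_orbits[OF f]] assms(2) Union_orbits[OF f]
    by (metis Sup_upper finite_subset)
  then show ?thesis
    by (simp add: perm_weight_def part_prod_def prod_dividef prod.distrib power_sum[symmetric])
qed

text \<open>Here \<open>k\<close> is the number of cycles missing from the planar maximum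
  \<open>n + 1\<close>. The sign comes from \<open>(- d) ^ k\<close>, and
  \<open>fact (n - 1)\<close> from the normalisation of the transitive sum.\<close>

definition genus_coeff :: "nat \<Rightarrow> nat \<Rightarrow> nat set set \<Rightarrow> nat set set \<Rightarrow> complex" where
  "genus_coeff n k \<sigma> \<tau> = (-1) ^ k / fact (n - 1) * of_nat (card {(f, g) \<in> transitive_pairs 1 {1..n}.
     card (orbits f {1..n}) + card (orbits g {1..n}) + k = Suc n \<and>
     orbits f {1..n} = \<sigma> \<and> orbits g {1..n} = \<tau>})"

text \<open>Group the pairs by the deficiency \<open>k\<close>. The group \<open>k = 0\<close> is
  the planar sum; the others are sorted further by the two cycle partitions, which determine the
  weight of a pair.\<close>

lemma transitive_sum_expansion:
  fixes a b :: "nat \<Rightarrow> complex"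
  assumes n: "n \<ge> 1" and d: "d > 0"
  shows "(\<Sum>(f, g)\<in>transitive_pairs 1 {1..n}.
      (- of_nat d) ^ (card (orbits f {1..n}) + card (orbits g {1..n})) / (- of_nat d) ^ Suc n *
      (perm_weight a {1..n} f * perm_weight b {1..n} g)) / fact (n - 1)
    = (\<Sum>\<pi>\<in>noncrossing_partitions n. part_prod a \<pi> * part_prod b (kreweras n \<pi>)) +
      (\<Sum>k=1..n-1. 1 / of_nat d ^ k * (\<Sum>\<sigma>\<in>set_partitions n. \<Sum>\<tau>\<in>set_partitions n.
        genus_coeff n k \<sigma> \<tau> * (part_prod a \<sigma> * part_prod b \<tau>)))"
proof -
  define A where "A = {1..n}"
  define X where "X = (- of_nat d :: complex)"
  have X: "X \<noteq> 0" using d by (simp add: X_def)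
  have fin: "finite A" and A1: "1 \<in> A" and cA: "card A = n" using n by (auto simp: A_def)
  define T where "T = transitive_pairs 1 A"
  have finT: "finite T" unfolding T_def by (rule finite_transitive_pairs[OF fin])
  define c where "c = (\<lambda>p :: (nat \<Rightarrow> nat) \<times> (nat \<Rightarrow> nat). card (orbits (fst p) A) + card (orbits (snd p) A))"
  define w where "w = (\<lambda>p. perm_weight a A (fst p) * perm_weight b A (snd p))"
  define T' where "T' k = {p \<in> T. Suc n - c p = k}" for k
  have c_le: "c p \<le> Suc n" and c_ge: "c p \<ge> 2" if "p \<in> T" for p
  proof -
    show "c p \<le> Suc n"
      using that transitive_pairs_card_orbits(1)[of "fst p" "snd p" 1 A] fin A1 cA
      by (simp add: c_def T_def)
    have "A \<noteq> {}" using A1 by auto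
    then show "c p \<ge> 2"
      unfolding c_def using card_orbits_pos[OF fin, of "fst p"] card_orbits_pos[OF fin, of "snd p"] by linarith
  qed
  have T'_iff: "p \<in> T' k \<longleftrightarrow> p \<in> T \<and> c p + k = Suc n" for p k
    using c_le[of p] by (auto simp: T'_def)
  have "(\<Sum>(f, g)\<in>transitive_pairs 1 {1..n}.
      (- of_nat d) ^ (card (orbits f {1..n}) + card (orbits g {1..n})) / (- of_nat d) ^ Suc n *
      (perm_weight a {1..n} f * perm_weight b {1..n} g)) = (\<Sum>p\<in>T. X ^ c p / X ^ Suc n * w p)"
    by (simp add: T_def A_def X_def c_def w_def case_prod_beta)
  also have "\<dots> = (\<Sum>k\<in>{0..n-1}. \<Sum>p\<in>T' k. X ^ c p / X ^ Suc n * w p)"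
    unfolding T'_def
  proof (rule sum.group[symmetric, OF finT])
    \<comment> \<open>Each of the two permutations has at least one cycle, hence the last possible
      deficiency is \<open>n - 1\<close>.\<close>
    show "(\<lambda>p. Suc n - c p) ` T \<subseteq> {0..n-1}" using c_ge by fastforce
  qed simp
  also have "\<dots> = (\<Sum>k\<in>{0..n-1}. 1 / X ^ k * (\<Sum>p\<in>T' k. w p))"
    unfolding sum_distrib_left
  proof (intro sum.cong refl)
    fix k p assume "p \<in> T' k"
    then have "X ^ Suc n = X ^ c p * X ^ k" by (simp add: T'_iff flip: power_add)
    then show "X ^ c p / X ^ Suc n * w p = 1 / X ^ k * w p" using X by simp
  qed
  also have "\<dots> = (\<Sum>p\<in>T' 0. w p) + (\<Sum>k=1..n-1. 1 / X ^ k * (\<Sum>p\<in>T' k. w p))"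
    by (simp add: sum.atLeast_Suc_atMost)
  also have "(\<Sum>p\<in>T' 0. w p) = fact (n - 1) *
      (\<Sum>\<pi>\<in>noncrossing_partitions n. part_prod a \<pi> * part_prod b (kreweras n \<pi>))"
  proof -
    have "T' 0 = {(f, g). (f, g) \<in> transitive_pairs 1 {1..n} \<and>
        card (orbits f {1..n}) + card (orbits g {1..n}) = Suc n}"
      by (auto simp: T'_iff T_def c_def A_def)
    then show ?thesis
      using sum_planar_transitive_pairs[OF n, of a b] by (simp add: w_def A_def case_prod_beta)
  qed
  also have "(\<Sum>k=1..n-1. 1 / X ^ k * (\<Sum>p\<in>T' k. w p)) = fact (n - 1) *
      (\<Sum>k=1..n-1. 1 / of_nat d ^ k * (\<Sum>\<sigma>\<in>set_partitions n. \<Sum>\<tau>\<in>set_partitions n.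
        genus_coeff n k \<sigma> \<tau> * (part_prod a \<sigma> * part_prod b \<tau>)))"
    unfolding sum_distrib_left[of "fact (n - 1)" "\<lambda>k. 1 / of_nat d ^ k * _ k"]
  proof (rule sum.cong[OF refl])
    fix k
    let ?P = "set_partitions n"
    define orb where "orb = (\<lambda>p :: (nat \<Rightarrow> nat) \<times> (nat \<Rightarrow> nat). (orbits (fst p) A, orbits (snd p) A))"
    have finP: "finite ?P" unfolding set_partitions_def by (rule finitely_many_partition_on) simp
    have finT': "finite (T' k)" using finT by (simp add: T'_def)
    have "orb ` T' k \<subseteq> ?P \<times> ?P"
      using partition_on_orbits[OF _ fin]
      by (auto simp: orb_def T'_iff T_def transitive_pairs_def set_partitions_def A_def)
    then have "(\<Sum>p\<in>T' k. w p) = (\<Sum>s\<in>?P \<times> ?P. \<Sum>p | p \<in> T' k \<and> orb p = s. w p)"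
      by (intro sum.group[symmetric] finT' finite_cartesian_product finP)
    also have "\<dots> = (\<Sum>s\<in>?P \<times> ?P. of_nat (card {p \<in> T' k. orb p = s}) *
        (part_prod a (fst s) * part_prod b (snd s)))"
      by (intro sum.cong refl) (auto simp: w_def orb_def perm_weight_def)
    also have "\<dots> = (\<Sum>\<sigma>\<in>?P. \<Sum>\<tau>\<in>?P. of_nat (card {p \<in> T' k. orb p = (\<sigma>, \<tau>)}) *
        (part_prod a \<sigma> * part_prod b \<tau>))"
      by (simp add: sum.cartesian_product case_prod_beta)
    finally have w: "(\<Sum>p\<in>T' k. w p) = (\<Sum>\<sigma>\<in>?P. \<Sum>\<tau>\<in>?P. of_nat (card {p \<in> T' k. orb p = (\<sigma>, \<tau>)}) *
        (part_prod a \<sigma> * part_prod b \<tau>))" .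
    have gc: "of_nat (card {p \<in> T' k. orb p = (\<sigma>, \<tau>)}) = fact (n - 1) * (-1) ^ k * genus_coeff n k \<sigma> \<tau>"
      for \<sigma> \<tau>
    proof -
      have "{p \<in> T' k. orb p = (\<sigma>, \<tau>)} = {(f, g) \<in> transitive_pairs 1 {1..n}.
          card (orbits f {1..n}) + card (orbits g {1..n}) + k = Suc n \<and>
          orbits f {1..n} = \<sigma> \<and> orbits g {1..n} = \<tau>}"
        by (auto simp: T'_iff T_def c_def orb_def A_def)
      then show ?thesis by (simp add: genus_coeff_def flip: power_mult_distrib)
    qed
    have X': "1 / of_nat d ^ k = 1 / X ^ k * (-1) ^ k"
      by (cases "even k") (simp_all add: X_def)
    then show "1 / X ^ k * (\<Sum>p\<in>T' k. w p) = fact (n - 1) *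
        (1 / of_nat d ^ k * (\<Sum>\<sigma>\<in>?P. \<Sum>\<tau>\<in>?P. genus_coeff n k \<sigma> \<tau> * (part_prod a \<sigma> * part_prod b \<tau>)))"
      unfolding w gc by (simp add: sum_distrib_left mult_ac X')
  qed
  finally show ?thesis by (simp add: field_simps)
qed

text \<open>The parameter \<open>y\<close> is \<open>- d\<close> for cumulants and \<open>- 1\<close> for moments.\<close>

lemma genus_expansion:
  fixes a b z :: "nat \<Rightarrow> complex"
  assumes F: "exp_recurrence d F (\<lambda>k. fact (k - 1) * (- of_nat d * a k / (- of_nat d) ^ k))"
    and G: "exp_recurrence d G (\<lambda>k. fact (k - 1) * (- of_nat d * b k / y ^ k))"
    and H: "exp_recurrence d H (\<lambda>k. fact (k - 1) * (- of_nat d * z k / y ^ k))"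
    and FG: "\<And>k. k \<le> d \<Longrightarrow> H k = F k * G k"
    and n: "1 \<le> n" "n \<le> d" and y: "y \<noteq> 0"
  shows "z n = (\<Sum>\<pi>\<in>noncrossing_partitions n. part_prod a \<pi> * part_prod b (kreweras n \<pi>)) +
      (\<Sum>k=1..n-1. 1 / of_nat d ^ k * (\<Sum>\<sigma>\<in>set_partitions n. \<Sum>\<tau>\<in>set_partitions n.
        genus_coeff n k \<sigma> \<tau> * (part_prod a \<sigma> * part_prod b \<tau>)))"
proof -
  define X where "X = (- of_nat d :: complex)"
  have X: "X \<noteq> 0" using n by (simp add: X_def)
  have mono: "exp_recurrence n K k" if "exp_recurrence d K k" for K k :: "nat \<Rightarrow> complex"
    using that n by (simp add: exp_recurrence_def)
  let ?A = "{1..n}"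
  have "fact (n - 1) * (X * z n / y ^ n) =
      transitive_sum (\<lambda>k. X * a k / X ^ k) (\<lambda>k. X * b k / y ^ k) 1 ?A"
    unfolding X_def using n FG
    by (intro transitive_sum_product[OF mono[OF F] mono[OF G] mono[OF H], symmetric]) auto
  \<comment> \<open>The scaled weights contribute \<open>X\<close> to the number of cycles over
    \<open>X ^ n * y ^ n\<close>. Splitting off \<open>X / y ^ n\<close>, the factor that also
    stands before \<open>z n\<close>, leaves the exponent \<open>Suc n\<close> below.\<close>
  also have "\<dots> = (\<Sum>(f, g)\<in>transitive_pairs 1 ?A. X / y ^ n *
      (X ^ (card (orbits f ?A) + card (orbits g ?A)) / X ^ Suc n *
        (perm_weight a ?A f * perm_weight b ?A g)))"
    unfolding transitive_sum_def
  proof (intro sum.cong refl, clarify)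
    fix f g assume "(f, g) \<in> transitive_pairs 1 ?A"
    then have "f permutes ?A" "g permutes ?A" by (auto simp: transitive_pairs_def)
    then show "perm_weight (\<lambda>k. X * a k / X ^ k) ?A f * perm_weight (\<lambda>k. X * b k / y ^ k) ?A g =
        X / y ^ n * (X ^ (card (orbits f ?A) + card (orbits g ?A)) / X ^ Suc n *
          (perm_weight a ?A f * perm_weight b ?A g))"
      using X y by (simp add: perm_weight_scaled power_add field_simps)
  qed
  also have "\<dots> = X / y ^ n * (\<Sum>(f, g)\<in>transitive_pairs 1 ?A.
      X ^ (card (orbits f ?A) + card (orbits g ?A)) / X ^ Suc n *
        (perm_weight a ?A f * perm_weight b ?A g))"
    unfolding sum_distrib_left by (intro sum.cong) auto
  finally have "z n = (\<Sum>(f, g)\<in>transitive_pairs 1 ?A.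
      X ^ (card (orbits f ?A) + card (orbits g ?A)) / X ^ Suc n *
        (perm_weight a ?A f * perm_weight b ?A g)) / fact (n - 1)"
    using X y by (simp add: field_simps)
  then show ?thesis
    unfolding X_def using transitive_sum_expansion[of n d a b] n by simp
qed

theorem theorem1p2:
  fixes n :: nat
  assumes "n \<ge> 1"
  shows "\<exists>c e :: nat \<Rightarrow> nat set set \<Rightarrow> nat set set \<Rightarrow> complex.
    \<forall>d (p :: complex poly) (q :: complex poly).
      d \<ge> n \<and> degree p = d \<and> lead_coeff p = 1 \<and> degree q = d \<and> lead_coeff q = 1 \<longrightarrow>
        ff_cumulant d (ff_mult_conv d p q) n =
          (\<Sum>\<pi>\<in>noncrossing_partitions n.
             part_prod (ff_cumulant d p) \<pi> * part_prod (ff_cumulant d q) (kreweras n \<pi>)) +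
          (\<Sum>k=1..n-1. 1 / of_nat d ^ k *
             (\<Sum>\<sigma>\<in>set_partitions n. \<Sum>\<tau>\<in>set_partitions n.
                c k \<sigma> \<tau> * (part_prod (ff_cumulant d p) \<sigma> * part_prod (ff_cumulant d q) \<tau>))) \<and>
        moment (ff_mult_conv d p q) n =
          (\<Sum>\<pi>\<in>noncrossing_partitions n.
             part_prod (ff_cumulant d p) \<pi> * part_prod (moment q) (kreweras n \<pi>)) +
          (\<Sum>k=1..n-1. 1 / of_nat d ^ k *
             (\<Sum>\<sigma>\<in>set_partitions n. \<Sum>\<tau>\<in>set_partitions n.
                e k \<sigma> \<tau> * (part_prod (ff_cumulant d p) \<sigma> * part_prod (moment q) \<tau>)))"
\<comment> \<open>Both expansions sum over the same pairs of permutations, so one witness serves for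
  \<open>c\<close> and for \<open>e\<close>.\<close>
proof (intro exI[of _ "genus_coeff n"] allI impI)
  fix d :: nat and p q :: "complex poly"
  assume *: "d \<ge> n \<and> degree p = d \<and> lead_coeff p = 1 \<and> degree q = d \<and> lead_coeff q = 1"
  then have n: "1 \<le> n" "n \<le> d" "d > 0" and p: "degree p = d" "lead_coeff p = 1"
    and q: "degree q = d" "lead_coeff q = 1" using assms by auto
  note r = ff_mult_conv_props[OF p q]
  \<comment> \<open>The version for moments: the single binomial is spent on \<open>p\<close>, and
    \<open>q\<close> keeps its unscaled coefficients. Dividing once more by
    \<open>falling d k\<close> gives the symmetric version for cumulants.\<close>
  have fall: "fact k * (sgn_coeff p k * sgn_coeff q k / of_nat (d choose k)) =
      fact k * sgn_coeff p k / of_nat (falling d k) * (fact k * sgn_coeff q k)" if "k \<le> d" for k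
    using that by (simp add: falling_eq)
  have fall': "fact k * (sgn_coeff p k * sgn_coeff q k / of_nat (d choose k)) / of_nat (falling d k) =
      fact k * sgn_coeff p k / of_nat (falling d k) * (fact k * sgn_coeff q k / of_nat (falling d k))"
    if "k \<le> d" for k
    using fall[OF that] by (simp only: times_divide_eq_right)
  show "ff_cumulant d (ff_mult_conv d p q) n =
          (\<Sum>\<pi>\<in>noncrossing_partitions n.
             part_prod (ff_cumulant d p) \<pi> * part_prod (ff_cumulant d q) (kreweras n \<pi>)) +
          (\<Sum>k=1..n-1. 1 / of_nat d ^ k *
             (\<Sum>\<sigma>\<in>set_partitions n. \<Sum>\<tau>\<in>set_partitions n.
                genus_coeff n k \<sigma> \<tau> *
                  (part_prod (ff_cumulant d p) \<sigma> * part_prod (ff_cumulant d q) \<tau>))) \<and>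
        moment (ff_mult_conv d p q) n =
          (\<Sum>\<pi>\<in>noncrossing_partitions n.
             part_prod (ff_cumulant d p) \<pi> * part_prod (moment q) (kreweras n \<pi>)) +
          (\<Sum>k=1..n-1. 1 / of_nat d ^ k *
             (\<Sum>\<sigma>\<in>set_partitions n. \<Sum>\<tau>\<in>set_partitions n.
                genus_coeff n k \<sigma> \<tau> * (part_prod (ff_cumulant d p) \<sigma> * part_prod (moment q) \<tau>)))"
    (is "?cumulants \<and> ?moments")
  proof
    show ?cumulants
      by (rule genus_expansion[OF exp_recurrence_cumulant[OF p n(3)] exp_recurrence_cumulant[OF q n(3)]
            exp_recurrence_cumulant[OF r(1,2) n(3)] _ n(1,2)])
        (use n in \<open>simp_all only: r(3) fall', simp_all\<close>)
    show ?moments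
      by (rule genus_expansion[OF exp_recurrence_cumulant[OF p n(3)] exp_recurrence_moment[OF q n(3)]
            exp_recurrence_moment[OF r(1,2) n(3)] _ n(1,2)])
        (simp_all only: r(3) fall, simp_all)
  qed
qed

end
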